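(* Let $H$ be an infinite-dimensional separable real Hilbert space, let $A\colon D(A)\subset H\to H$ be a nonnegative self-adjoint operator with compact resolvent, and let $E=D(A^{1/2})$. Let $I\in C^1(E,\mathbb{R})$ satisfy $I(0)=0$, $I'(0)=0$ and: (i) $u_k\rightharpoonup u$ weakly in $E$ implies $I(u_k)\to I(u)$; (ii) $I(u)>0$ for $u\in E\setminus\{0\}$; (iii) for every $u\in E\setminus\{0\}$ the function $t\mapsto I(tu)/t^2$ is nondecreasing on $(0,\infty)$, with limit $0$ as $t\to0^+$ and limit $+\infty$ as $t\to+\infty$; (iv) for all $u\in E\setminus\{0\}$, $v\in E$ and $s\ge-1$, $I(u)-I((1+s)u+v)+I'(u)[s(s/2+1)u+(1+s)v]\le0$, with strict inequality if $v=0$ and $s\ne0$. Let $n\ge1$ be an integer with $\lambda_n<\lambda_{n+1}$ and let $\lambda\in(\lambda_n,\lambda_{n+1})$. Then the Nehari-Pankov set $\mathcal{NP}_\lambda$ is non-empty and contains all nonzero critical points of $\mathcal{J}_\lambda$. Moreover, $$c_\lambda:=\inf_{\mathcal{NP}_\lambda}\mathcal{J}_\lambda=\inf_{u\in E\setminus E_n}\ \sup_{F_n(u)^+}\mathcal{J}_\lambda>0.$$ Moreover, the first infimum is attained, and every minimizer of $\mathcal{J}_\lambda$ on $\mathcal{NP}_\lambda$ is a critical point of $\mathcal{J}_\lambda$. Thus, all minimizers of $\mathcal{J}_\lambda$ on $\mathcal{NP}_\lambda$ are ground state solutions (i.e. nonzero critical points of $\mathcal{J}_\lambda$ of least action among all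 nonzero critical points) of $Au=\lambda u+I'(u)$.
   Context: $E$ is a Hilbert space with scalar product $\langle u,v\rangle_E=\langle u,v\rangle_H+\langle A^{1/2}u,A^{1/2}v\rangle_H$. The eigenvalues of $A$, counted with multiplicity, are $0\le\lambda_1\le\lambda_2\le\dots\to+\infty$, and $(\zeta_k)_{k\ge1}$ is an orthonormal basis of $H$ of associated eigenfunctions, $A\zeta_k=\lambda_k\zeta_k$. For $\lambda\in\mathbb{R}$ and $u,v\in E$: $q_\lambda(u,v)=\langle A^{1/2}u,A^{1/2}v\rangle_H-\lambda\langle u,v\rangle_H$, $q_\lambda(u)=q_\lambda(u,u)$, and $\mathcal{J}_\lambda(u)=\frac12q_\lambda(u)-I(u)$. The equation $Au=\lambda u+I'(u)$ is understood in the weak sense in the dual $E'$, i.e. as $\mathcal{J}_\lambda'(u)=0$. Set $E_n=\operatorname{span}\{\zeta_1,\dots,\zeta_n\}$ and, for $u\in E\setminus E_n$, $F_n(u)=E_n\oplus\mathbb{R}u$ and $F_n(u)^+=\{v+tu: v\in E_n,\ t>0\}$. For $\lambda\in(\lambda_n,\lambda_{n+1})$, the Nehari-Pankov set is $\mathcal{NP}_\lambda=\{u\in E\setminus E_n: \mathcal{J}_\lambda'(u)w=0\text{ for all }w\in F_n(u)\}$. *)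

theory Defs
  imports "HOL-Analysis.Analysis"
begin

text \<open>A (possibly unbounded) linear operator \<open>A : D(A) \<subset> H \<rightarrow> H\<close> is represented by its graph
  \<open>{(u, A u) | u \<in> D(A)}\<close>, so \<^term>\<open>Domain A\<close> is \<open>D(A)\<close>, \<^term>\<open>B O B\<close> is the square of \<^term>\<open>B\<close>
  on its maximal domain \<open>{u \<in> D(B). B u \<in> D(B)}\<close>, and equality of graphs includes equality of domains.\<close>

definition linear_operator :: "('h::real_vector \<times> 'h) set \<Rightarrow> bool" where
  "linear_operator A \<longleftrightarrow> subspace A \<and> single_valued A"

definition op_apply :: "('h \<times> 'h) set \<Rightarrow> 'h \<Rightarrow> 'h" where
  "op_apply A u = (THE v. (u, v) \<in> A)"

definition adjoint_operator :: "('h::real_inner \<times> 'h) set \<Rightarrow> ('h \<times> 'h) set" where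
  "adjoint_operator A = {(v, w). \<forall>(x, y)\<in>A. y \<bullet> v = x \<bullet> w}"

definition self_adjoint :: "('h::real_inner \<times> 'h) set \<Rightarrow> bool" where
  "self_adjoint A \<longleftrightarrow>
     linear_operator A \<and> closure (Domain A) = UNIV \<and> adjoint_operator A = A"

definition nonneg_operator :: "('h::real_inner \<times> 'h) set \<Rightarrow> bool" where
  "nonneg_operator A \<longleftrightarrow> (\<forall>(u, v)\<in>A. 0 \<le> v \<bullet> u)"

definition compact_linear_map :: "('h::real_normed_vector \<Rightarrow> 'h) \<Rightarrow> bool" where
  "compact_linear_map R \<longleftrightarrow> linear R \<and> (\<forall>B. bounded B \<longrightarrow> compact (closure (R ` B)))"

text \<open>\<^term>\<open>R\<close> is the everywhere defined bounded inverse of \<open>A - \<mu>\<close>.\<close>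

definition is_resolvent :: "('h::real_normed_vector \<times> 'h) set \<Rightarrow> real \<Rightarrow> ('h \<Rightarrow> 'h) \<Rightarrow> bool" where
  "is_resolvent A \<mu> R \<longleftrightarrow>
     bounded_linear R \<and> (\<forall>f u. R f = u \<longleftrightarrow> (u, f + \<mu> *\<^sub>R u) \<in> A)"

text \<open>By the resolvent identity it does not matter which point of the resolvent set is used.\<close>

definition compact_resolvent :: "('h::real_normed_vector \<times> 'h) set \<Rightarrow> bool" where
  "compact_resolvent A \<longleftrightarrow> (\<exists>\<mu> R. is_resolvent A \<mu> R \<and> compact_linear_map R)"

text \<open>\<open>A\<^sup>1\<^sup>/\<^sup>2\<close>: the unique nonnegative self-adjoint operator whose square is \<^term>\<open>A\<close>.\<close>

definition op_sqrt :: "('h::real_inner \<times> 'h) set \<Rightarrow> ('h \<times> 'h) set" where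
  "op_sqrt A = (THE B. self_adjoint B \<and> nonneg_operator B \<and> B O B = A)"

text \<open>Eigenvalues and eigenfunctions are indexed by \<open>k \<ge> 1\<close>; the values at \<open>0\<close> are irrelevant.
  Because the \<open>\<zeta> k\<close> form an orthonormal basis, \<open>\<Lambda>\<close> lists each eigenvalue according to its multiplicity.\<close>

definition eigen_basis ::
    "('h::real_inner \<times> 'h) set \<Rightarrow> (nat \<Rightarrow> real) \<Rightarrow> (nat \<Rightarrow> 'h) \<Rightarrow> bool" where
  "eigen_basis A \<Lambda> \<zeta> \<longleftrightarrow>
     (\<forall>k\<ge>1. (\<zeta> k, \<Lambda> k *\<^sub>R \<zeta> k) \<in> A) \<and>
     (\<forall>k\<ge>1. \<forall>l\<ge>1. \<zeta> k \<bullet> \<zeta> l = (if k = l then 1 else 0)) \<and>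
     closure (span (\<zeta> ` {1..})) = UNIV \<and>
     0 \<le> \<Lambda> 1 \<and> mono_on {1..} \<Lambda> \<and> filterlim \<Lambda> at_top sequentially"

text \<open>The Hilbert space \<open>E = D(A\<^sup>1\<^sup>/\<^sup>2)\<close> with the scalar product
  \<open>\<langle>u,v\<rangle>\<^sub>H + \<langle>A\<^sup>1\<^sup>/\<^sup>2 u, A\<^sup>1\<^sup>/\<^sup>2 v\<rangle>\<^sub>H\<close> has a norm different from that of \<open>H\<close>. It is carried by a type of
  its own, \<open>'e\<close>, so that the derivative, the dual and the topology of \<open>E\<close> are those of the
  library; \<open>\<iota>\<close> is the inclusion of \<open>E\<close> into \<open>H\<close>. Up to isometry this is no restriction on
  \<open>E\<close>: in the separable infinite-dimensional case already \<open>'e = 'h\<close> admits such an \<open>\<iota>\<close>.\<close>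

definition energy_space ::
    "('h::real_inner \<times> 'h) set \<Rightarrow> ('e::real_inner \<Rightarrow> 'h) \<Rightarrow> bool" where
  "energy_space A \<iota> \<longleftrightarrow>
     linear \<iota> \<and> bij_betw \<iota> UNIV (Domain (op_sqrt A)) \<and>
     (\<forall>u v. u \<bullet> v =
        \<iota> u \<bullet> \<iota> v + op_apply (op_sqrt A) (\<iota> u) \<bullet> op_apply (op_sqrt A) (\<iota> v))"

definition weakly_converges :: "(nat \<Rightarrow> 'e::real_normed_vector) \<Rightarrow> 'e \<Rightarrow> bool" where
  "weakly_converges x l \<longleftrightarrow>
     (\<forall>f :: 'e \<Rightarrow>\<^sub>L real. (\<lambda>k. blinfun_apply f (x k)) \<longlonglongrightarrow> blinfun_apply f l)"

definition q_form ::
    "('h::real_inner \<times> 'h) set \<Rightarrow> ('e \<Rightarrow> 'h) \<Rightarrow> real \<Rightarrow> 'e \<Rightarrow> 'e \<Rightarrow> real" where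
  "q_form A \<iota> lam u v =
     op_apply (op_sqrt A) (\<iota> u) \<bullet> op_apply (op_sqrt A) (\<iota> v) - lam * (\<iota> u \<bullet> \<iota> v)"

definition J_fun ::
    "('h::real_inner \<times> 'h) set \<Rightarrow> ('e \<Rightarrow> 'h) \<Rightarrow> ('e \<Rightarrow> real) \<Rightarrow> real \<Rightarrow> 'e \<Rightarrow> real" where
  "J_fun A \<iota> I lam u = 1/2 * q_form A \<iota> lam u u - I u"

definition critical_point :: "('e::real_normed_vector \<Rightarrow> real) \<Rightarrow> 'e \<Rightarrow> bool" where
  "critical_point J u \<longleftrightarrow> (J has_derivative (\<lambda>w. 0)) (at u)"

text \<open>For \<^term>\<open>J_fun A \<iota> I lam\<close> the critical points are by definition the weak solutions
  of \<open>A u = \<lambda> u + I'(u)\<close> in \<open>E'\<close>.\<close>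

definition ground_state :: "('e::real_normed_vector \<Rightarrow> real) \<Rightarrow> 'e \<Rightarrow> bool" where
  "ground_state J u \<longleftrightarrow> is_arg_min J (\<lambda>v. v \<noteq> 0 \<and> critical_point J v) u"

definition E_sub :: "('e \<Rightarrow> 'h::real_vector) \<Rightarrow> (nat \<Rightarrow> 'h) \<Rightarrow> nat \<Rightarrow> 'e set" where
  "E_sub \<iota> \<zeta> n = {u. \<iota> u \<in> span (\<zeta> ` {1..n})}"

definition F_sub ::
    "('e::real_vector \<Rightarrow> 'h::real_vector) \<Rightarrow> (nat \<Rightarrow> 'h) \<Rightarrow> nat \<Rightarrow> 'e \<Rightarrow> 'e set" where
  "F_sub \<iota> \<zeta> n u = {v + t *\<^sub>R u | v t. v \<in> E_sub \<iota> \<zeta> n}"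

definition F_plus ::
    "('e::real_vector \<Rightarrow> 'h::real_vector) \<Rightarrow> (nat \<Rightarrow> 'h) \<Rightarrow> nat \<Rightarrow> 'e \<Rightarrow> 'e set" where
  "F_plus \<iota> \<zeta> n u = {v + t *\<^sub>R u | v t. v \<in> E_sub \<iota> \<zeta> n \<and> t > 0}"

definition Nehari_Pankov ::
    "('h::real_inner \<times> 'h) set \<Rightarrow> ('e::real_inner \<Rightarrow> 'h) \<Rightarrow> (nat \<Rightarrow> 'h) \<Rightarrow>
     ('e \<Rightarrow> real) \<Rightarrow> nat \<Rightarrow> real \<Rightarrow> 'e set" where
  "Nehari_Pankov A \<iota> \<zeta> I n lam =
     {u. u \<notin> E_sub \<iota> \<zeta> n \<and>
         (\<forall>w\<in>F_sub \<iota> \<zeta> n u. frechet_derivative (J_fun A \<iota> I lam) (at u) w = 0)}"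

end

theory Submission
  imports Defs "HOL-Complex_Analysis.Great_Picard"
begin

text \<open>
  Write \<open>V\<close> for the span of the first \<open>n\<close> eigenfunctions and call \<open>{t u + v | t > 0, v \<in> V}\<close> the
  half-space of \<open>u\<close>. As \<open>lam\<close> lies in a spectral gap, the form \<open>q\<close> is negative definite on \<open>V\<close>,
  coercive on the orthogonal complement of \<open>V\<close>, and does not couple the two.

  The convexity-like inequality for \<open>I\<close> says exactly that a point \<open>u\<close> of the Nehari--Pankov set is the
  strict global maximizer of the functional \<open>J\<close> on its half-space (\<open>NP_maximal\<close>). Conversely \<open>J\<close> has
  a maximizer on every half-space, since half-spaces are finite-dimensional and the superquadratic
  growth of \<open>I\<close> drives \<open>J\<close> below zero at infinity (\<open>half_space_meets_NP\<close>). These two facts give the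
  minimax formula, and \<open>J > 0\<close> on the Nehari--Pankov set.

  The infimum is attained (\<open>exists_minimizer\<close>) because only the half-space of a minimizing point
  matters. It is determined by a unit vector orthogonal to \<open>V\<close>, and a weak limit of such vectors along a
  minimizing sequence is nonzero and determines a half-space whose maximizer is a minimizer: \<open>I\<close> is
  weakly continuous and \<open>q\<close> is weakly lower semicontinuous on the complement of \<open>V\<close>.

  A minimizer \<open>u\<close> is critical (\<open>minimizer_critical\<close>): if \<open>J\<close> increased in a direction \<open>\<phi>\<close>, the maximum
  of \<open>J\<close> over the half-space of \<open>u - \<epsilon> \<phi>\<close> would fall below the minimum of \<open>J\<close> for small \<open>\<epsilon>\<close>.
  Nonzero critical points belong to the Nehari--Pankov set (\<open>critical_imp_NP\<close>), so minimizers are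
  ground states.

  The remaining work identifies the spectral data. The square root of \<open>A\<close> is defined by a unique
  description, and both existence and uniqueness come from the eigenbasis
  (\<open>op_sqrt_eq_diagonal_operator\<close>): every self-adjoint operator with this eigenbasis is diagonal. This
  yields an orthonormal basis of \<open>E\<close> that diagonalizes \<open>q\<close> (\<open>q_form_sums\<close>), and such a basis makes
  bounded sequences weakly sequentially compact
  (\<open>bounded_imp_weakly_convergent_subsequence\<close>).
\<close>

section \<open>Orthonormal bases and weak compactness in Hilbert spaces\<close>

locale hilbert_basis =
  fixes b :: "nat \<Rightarrow> 'a::{real_inner, complete_space}"
  assumes orthonormal: "b i \<bullet> b j = (if i = j then 1 else 0)"
    and total: "(\<And>i. x \<bullet> b i = 0) \<Longrightarrow> x = 0"
begin

lemma inner_finite_sum: "(\<Sum>i\<in>S. c i *\<^sub>R b i) \<bullet> b j = (if j \<in> S then c j else 0)" if "finite S"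
proof -
  have "(\<Sum>i\<in>S. c i *\<^sub>R b i) \<bullet> b j = (\<Sum>i\<in>S. if i = j then c i else 0)"
    by (auto simp: inner_sum_left orthonormal intro!: sum.cong)
  then show ?thesis
    using that by simp
qed

lemma norm_finite_sum_sq: "(norm (\<Sum>i\<in>S. c i *\<^sub>R b i))\<^sup>2 = (\<Sum>i\<in>S. (c i)\<^sup>2)" if "finite S"
proof -
  have "(norm (\<Sum>i\<in>S. c i *\<^sub>R b i))\<^sup>2 = (\<Sum>j\<in>S. c j * ((\<Sum>i\<in>S. c i *\<^sub>R b i) \<bullet> b j))"
    by (subst power2_norm_eq_inner, subst inner_sum_right) simp
  also have "\<dots> = (\<Sum>j\<in>S. (c j)\<^sup>2)"
    using that by (intro sum.cong) (auto simp: inner_finite_sum power2_eq_square)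
  finally show ?thesis .
qed

lemma bessel: "(\<Sum>i<N. (x \<bullet> b i)\<^sup>2) \<le> (norm x)\<^sup>2"
proof -
  let ?s = "\<Sum>i<N. (x \<bullet> b i) *\<^sub>R b i"
  have 1: "?s \<bullet> ?s = (\<Sum>i<N. (x \<bullet> b i)\<^sup>2)"
    using norm_finite_sum_sq[of "{..<N}" "\<lambda>i. x \<bullet> b i"] by (simp add: power2_norm_eq_inner)
  have 2: "x \<bullet> ?s = (\<Sum>i<N. (x \<bullet> b i)\<^sup>2)"
    by (simp add: inner_sum_right power2_eq_square)
  have "0 \<le> (x - ?s) \<bullet> (x - ?s)" by simp
  also have "\<dots> = x \<bullet> x - (\<Sum>i<N. (x \<bullet> b i)\<^sup>2)"
    using 1 2 by (simp add: inner_diff_left inner_diff_right inner_commute)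
  finally show ?thesis by (simp add: power2_norm_eq_inner)
qed

text \<open>By Pythagoras the squared distance of two partial sums is a block of the convergent series of
  squares, so the partial sums are Cauchy; completeness enters only here.\<close>

lemma riesz_fischer:
  assumes "summable (\<lambda>i. (c i)\<^sup>2)"
  obtains x where "\<And>i. x \<bullet> b i = c i" "(\<lambda>i. c i *\<^sub>R b i) sums x"
proof -
  let ?s = "\<lambda>N. \<Sum>i<N. c i *\<^sub>R b i"
  have "Cauchy ?s"
  proof (rule CauchyI', goal_cases)
    case (1 e)
    from assms obtain M where M: "\<And>m n. m \<ge> M \<Longrightarrow> norm (\<Sum>i=m..<n. (c i)\<^sup>2) < e\<^sup>2"
      unfolding summable_Cauchy using 1 by (meson zero_less_power)
    have "dist (?s m) (?s n) < e" if "m \<ge> M" "n > m" for m n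
    proof -
      have "{..<n} = {..<m} \<union> {m..<n}"
        using that by auto
      then have "?s n = ?s m + (\<Sum>i=m..<n. c i *\<^sub>R b i)"
        by (simp add: sum.union_disjoint disjoint_iff)
      then have "(dist (?s m) (?s n))\<^sup>2 = (\<Sum>i=m..<n. (c i)\<^sup>2)"
        by (simp add: dist_norm norm_finite_sum_sq)
      also have "\<dots> < e\<^sup>2"
        using M[OF that(1), of n] by (simp add: sum_nonneg)
      finally show ?thesis
        using 1 by (simp add: power2_less_imp_less)
    qed
    then show ?case by blast
  qed
  then obtain x where x: "?s \<longlonglongrightarrow> x"
    using Cauchy_convergent convergent_def by blast
  have "x \<bullet> b i = c i" for i
  proof (rule LIMSEQ_unique)
    show "(\<lambda>N. ?s N \<bullet> b i) \<longlonglongrightarrow> x \<bullet> b i"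
      using x by (intro tendsto_intros)
    show "(\<lambda>N. ?s N \<bullet> b i) \<longlonglongrightarrow> c i"
      by (rule tendsto_eventually, rule eventually_sequentiallyI[of "Suc i"])
        (simp add: inner_finite_sum)
  qed
  then show ?thesis using that[of x] x by (simp add: sums_def)
qed

lemma eqI: "(\<And>i. x \<bullet> b i = y \<bullet> b i) \<Longrightarrow> x = y"
  using total[of "x - y"] by (simp add: inner_diff_left)

lemma summable_coeff_sq: "summable (\<lambda>i. (x \<bullet> b i)\<^sup>2)"
  by (rule summableI_nonneg_bounded[where x = "(norm x)\<^sup>2"]) (auto simp: bessel)

text \<open>Riesz--Fischer applied to the coefficients of \<open>x\<close> yields a convergent expansion whose sum has
  the same coefficients as \<open>x\<close>, hence equals \<open>x\<close> by totality.\<close>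

lemma fourier_sums: "(\<lambda>i. (x \<bullet> b i) *\<^sub>R b i) sums x"
proof -
  obtain y where y: "\<And>i. y \<bullet> b i = x \<bullet> b i" "(\<lambda>i. (x \<bullet> b i) *\<^sub>R b i) sums y"
    using riesz_fischer[OF summable_coeff_sq, of x] by blast
  then show ?thesis
    using eqI[of y x] by simp
qed

lemma parseval: "(\<lambda>i. (x \<bullet> b i) * (y \<bullet> b i)) sums (x \<bullet> y)"
  using bounded_linear.sums[OF bounded_linear_inner_left fourier_sums, of y x]
  by (simp add: inner_commute[of "b _"] inner_commute[of y x] mult.commute)

text \<open>The Riesz representation theorem. Testing \<open>f\<close> on \<open>\<Sum>i<N. f (b i) *\<^sub>R b i\<close> bounds
  \<open>\<Sum>i<N. (f (b i))\<^sup>2\<close> by the square of the operator bound of \<open>f\<close>, so Riesz--Fischer provides the vector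
  with coefficients \<open>f (b i)\<close>.\<close>

lemma bounded_linear_eq_inner:
  fixes f :: "'a \<Rightarrow> real"
  assumes "bounded_linear f"
  obtains a where "\<And>y. f y = y \<bullet> a"
proof -
  interpret f: bounded_linear f by fact
  obtain K where K: "\<And>x. \<bar>f x\<bar> \<le> norm x * K" "K > 0"
    using f.pos_bounded by auto
  have "(\<Sum>i<N. (f (b i))\<^sup>2) \<le> K\<^sup>2" for N
  proof -
    let ?S = "\<Sum>i<N. (f (b i))\<^sup>2"
    let ?x = "\<Sum>i<N. f (b i) *\<^sub>R b i"
    have S: "(norm ?x)\<^sup>2 = ?S"
      by (simp add: norm_finite_sum_sq)
    have "f ?x = ?S"
      by (simp add: f.sum f.scaleR power2_eq_square)
    then have "norm ?x * norm ?x \<le> norm ?x * K"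
      using K(1)[of ?x] S by (simp add: power2_eq_square)
    then have "norm ?x \<le> K"
      using K(2) by (cases "norm ?x = 0") auto
    then show ?thesis
      unfolding S[symmetric] by (simp add: power_mono)
  qed
  then have "summable (\<lambda>i. (f (b i))\<^sup>2)"
    by (intro summableI_nonneg_bounded[where x = "K\<^sup>2"]) auto
  then obtain a where a: "\<And>i. a \<bullet> b i = f (b i)"
    using riesz_fischer[of "\<lambda>i. f (b i)"] by blast
  have "f y = y \<bullet> a" for y
  proof (rule sums_unique2)
    show "(\<lambda>i. f ((y \<bullet> b i) *\<^sub>R b i)) sums f y"
      using assms fourier_sums by (rule bounded_linear.sums)
    show "(\<lambda>i. f ((y \<bullet> b i) *\<^sub>R b i)) sums (y \<bullet> a)"
      using parseval[of y a] by (simp add: f.scaleR a)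
  qed
  then show ?thesis using that by blast
qed

lemma weakly_convergesI:
  fixes x :: "nat \<Rightarrow> 'a"
  assumes "\<And>y. (\<lambda>k. x k \<bullet> y) \<longlonglongrightarrow> l \<bullet> y"
  shows "weakly_converges x l"
  unfolding weakly_converges_def
proof
  fix f :: "'a \<Rightarrow>\<^sub>L real"
  obtain a where "\<And>y. blinfun_apply f y = y \<bullet> a"
    using bounded_linear_eq_inner[OF blinfun.bounded_linear_right] by blast
  then show "(\<lambda>k. blinfun_apply f (x k)) \<longlonglongrightarrow> blinfun_apply f l"
    using assms by simp
qed

text \<open>A diagonal argument makes all Fourier coefficients converge; Bessel's inequality bounds the
  limits, so that they are the coefficients of some \<open>l\<close>; boundedness of the sequence extends the
  convergence from finite combinations of the basis to all test vectors.\<close>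

lemma bounded_imp_weakly_convergent_subsequence:
  fixes x :: "nat \<Rightarrow> 'a"
  assumes M: "\<And>k. norm (x k) \<le> M"
  obtains r l where "strict_mono (r :: nat \<Rightarrow> nat)" "weakly_converges (\<lambda>k. x (r k)) l"
proof -
  have *: "norm (x k \<bullet> b i) \<le> M" for k i
  proof -
    have "norm (b i) = 1"
      by (simp add: norm_eq_sqrt_inner orthonormal)
    then show ?thesis
      using Cauchy_Schwarz_ineq2[of "x k" "b i"] M[of k] by simp
  qed
  obtain r :: "nat \<Rightarrow> nat" where r: "strict_mono r"
    and "\<And>i. i \<in> UNIV \<Longrightarrow> \<exists>c. (\<lambda>k. x (r k) \<bullet> b i) \<longlonglongrightarrow> c"
    by (rule function_convergent_subsequence[of UNIV "\<lambda>k i. x k \<bullet> b i" M]) (use * in auto)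
  then obtain c where c: "\<And>i. (\<lambda>k. x (r k) \<bullet> b i) \<longlonglongrightarrow> c i"
    by (metis UNIV_I)
  have "(\<Sum>i<N. (c i)\<^sup>2) \<le> M\<^sup>2" for N
  proof (rule LIMSEQ_le_const2)
    show "(\<lambda>k. \<Sum>i<N. (x (r k) \<bullet> b i)\<^sup>2) \<longlonglongrightarrow> (\<Sum>i<N. (c i)\<^sup>2)"
      by (intro tendsto_intros c)
    show "\<exists>N'. \<forall>k\<ge>N'. (\<Sum>i<N. (x (r k) \<bullet> b i)\<^sup>2) \<le> M\<^sup>2"
      using bessel M by (meson norm_ge_zero order_trans power_mono)
  qed
  then have "summable (\<lambda>i. (c i)\<^sup>2)"
    by (intro summableI_nonneg_bounded[where x = "M\<^sup>2"]) auto
  then obtain l where l: "\<And>i. l \<bullet> b i = c i"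
    using riesz_fischer by blast
  define d where "d k = x (r k) - l" for k
  have d0: "(\<lambda>k. d k \<bullet> b i) \<longlonglongrightarrow> 0" for i
    using tendsto_diff[OF c tendsto_const, of i "c i"] by (simp add: d_def inner_diff_left l)
  define D where "D = M + norm l + 1"
  have D: "norm (d k) \<le> D" for k
    unfolding d_def D_def using M[of "r k"] norm_triangle_ineq4[of "x (r k)" l] by linarith
  have "D > 0"
    unfolding D_def using M[of 0] norm_ge_zero[of "x 0"] norm_ge_zero[of l] by linarith
  have "(\<lambda>k. d k \<bullet> y) \<longlonglongrightarrow> 0" for y
  proof (rule LIMSEQ_I)
    fix e :: real assume e: "e > 0"
    define s where "s N = (\<Sum>i<N. (y \<bullet> b i) *\<^sub>R b i)" for N
    have "s \<longlonglongrightarrow> y"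
      using fourier_sums[of y] by (simp add: s_def[abs_def] sums_def)
    then obtain N where N: "norm (s N - y) < e / (2 * D)"
      using LIMSEQ_D[of s y "e / (2 * D)"] e \<open>D > 0\<close> by auto
    have "(\<lambda>k. d k \<bullet> s N) \<longlonglongrightarrow> (\<Sum>i<N. (y \<bullet> b i) * 0)"
      unfolding s_def inner_sum_right inner_scaleR_right by (intro tendsto_intros d0)
    then have "(\<lambda>k. d k \<bullet> s N) \<longlonglongrightarrow> 0" by simp
    then obtain k0 where k0: "\<And>k. k \<ge> k0 \<Longrightarrow> \<bar>d k \<bullet> s N\<bar> < e / 2"
      using LIMSEQ_D[of _ 0 "e/2"] e by fastforce
    have "\<bar>d k \<bullet> y\<bar> < e" if "k \<ge> k0" for k
    proof -
      have "\<bar>d k \<bullet> (s N - y)\<bar> \<le> D * (e / (2 * D))"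
        using Cauchy_Schwarz_ineq2[of "d k" "s N - y"] D[of k] N \<open>D > 0\<close>
        by (smt (verit) mult_mono norm_ge_zero)
      then have "\<bar>d k \<bullet> (s N - y)\<bar> \<le> e / 2"
        using \<open>D > 0\<close> by simp
      then show ?thesis
        using k0[OF that] unfolding inner_diff_right by linarith
    qed
    then show "\<exists>k0. \<forall>k\<ge>k0. norm (d k \<bullet> y - 0) < e" by auto
  qed
  then have "(\<lambda>k. x (r k) \<bullet> y) \<longlonglongrightarrow> l \<bullet> y" for y
    using Lim_null[of "\<lambda>k. x (r k) \<bullet> y" "l \<bullet> y" sequentially]
    by (simp add: d_def inner_diff_left)
  then show ?thesis
    using that[OF r weakly_convergesI] by blast
qed

end

lemma weakly_converges_bounded_linear:
  fixes f :: "'a::real_normed_vector \<Rightarrow> real"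
  assumes "weakly_converges x l" "bounded_linear f"
  shows "(\<lambda>k. f (x k)) \<longlonglongrightarrow> f l"
  using assms(1) unfolding weakly_converges_def
  by (metis bounded_linear_Blinfun_apply[OF assms(2)])

lemma weakly_converges_affine:
  assumes "weakly_converges x l"
  shows "weakly_converges (\<lambda>k. t *\<^sub>R x k + v) (t *\<^sub>R l + v)"
  using assms unfolding weakly_converges_def
  by (simp add: blinfun.add_right blinfun.scaleR_right tendsto_add tendsto_mult)

text \<open>By induction, the combinations of \<open>S\<close> with coefficients in \<open>[-R, R]\<close> form a compact set; for
  orthonormal \<open>S\<close> this set contains the ball of radius \<open>R\<close> of the span.\<close>

lemma compact_span_cball:
  fixes S :: "'a::real_inner set"
  assumes "finite S" and S: "\<And>x y. x \<in> S \<Longrightarrow> y \<in> S \<Longrightarrow> x \<bullet> y = (if x = y then 1 else 0)"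
  shows "compact (span S \<inter> cball 0 R)"
proof -
  define K where "K T = {\<Sum>x\<in>T. c x *\<^sub>R x | c. \<forall>x\<in>T. c x \<in> {-R..R}}" for T :: "'a set"
  have "compact (K S)"
    using \<open>finite S\<close>
  proof (induction S)
    case empty
    then show ?case by (simp add: K_def)
  next
    case (insert x T)
    have "K (insert x T) = {y + z | y z. y \<in> (\<lambda>c. c *\<^sub>R x) ` {-R..R} \<and> z \<in> K T}" (is "_ = ?P")
    proof (intro equalityI subsetI)
      fix y assume "y \<in> K (insert x T)"
      then obtain c where "y = (\<Sum>x\<in>insert x T. c x *\<^sub>R x)" "\<forall>x\<in>insert x T. c x \<in> {-R..R}"
        by (auto simp: K_def)
      then have "y = c x *\<^sub>R x + (\<Sum>x\<in>T. c x *\<^sub>R x)" "c x \<in> {-R..R}" "(\<Sum>x\<in>T. c x *\<^sub>R x) \<in> K T"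
        using insert.hyps unfolding K_def by (simp, simp, blast)
      then show "y \<in> ?P"
        by blast
    next
      fix y assume "y \<in> ?P"
      then obtain a c where y: "y = a *\<^sub>R x + (\<Sum>x\<in>T. c x *\<^sub>R x)" and a: "a \<in> {-R..R}"
        and c: "\<forall>x\<in>T. c x \<in> {-R..R}"
        by (auto simp: K_def)
      have "(\<Sum>z\<in>T. (c(x := a)) z *\<^sub>R z) = (\<Sum>x\<in>T. c x *\<^sub>R x)"
        using insert by (intro sum.cong) auto
      then have "y = (\<Sum>z\<in>insert x T. (c(x := a)) z *\<^sub>R z)"
        using insert y by simp
      then show "y \<in> K (insert x T)"
        unfolding K_def using a c by (intro CollectI exI[of _ "c(x := a)"]) auto
    qed
    moreover have "compact ((\<lambda>c. c *\<^sub>R x) ` {-R..R})"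
      by (intro compact_continuous_image continuous_intros) auto
    ultimately show ?case
      using compact_sums[OF _ insert.IH] by simp
  qed
  moreover have "span S \<inter> cball 0 R = K S \<inter> cball 0 R"
  proof (intro equalityI subsetI)
    fix y assume y: "y \<in> span S \<inter> cball 0 R"
    then obtain c where c: "y = (\<Sum>x\<in>S. c x *\<^sub>R x)"
      using \<open>finite S\<close> by (auto simp: span_finite)
    have "c x \<in> {-R..R}" if "x \<in> S" for x
    proof -
      have "y \<bullet> x = (\<Sum>z\<in>S. if z = x then c z else 0)"
        unfolding c inner_sum_left using that S by (intro sum.cong) auto
      then have "c x = y \<bullet> x"
        using that \<open>finite S\<close> by simp
      moreover have "norm x = 1"
        using S[of x x] that by (simp add: norm_eq_sqrt_inner)
      ultimately have "\<bar>c x\<bar> \<le> R"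
        using Cauchy_Schwarz_ineq2[of y x] y by simp
      then show ?thesis by auto
    qed
    then show "y \<in> K S \<inter> cball 0 R"
      using y c by (auto simp: K_def)
  next
    fix y assume "y \<in> K S \<inter> cball 0 R"
    then show "y \<in> span S \<inter> cball 0 R"
      by (auto simp: K_def intro!: span_sum span_scale intro: span_base)
  qed
  ultimately show ?thesis
    using compact_Int_closed by auto
qed

section \<open>Self-adjoint operators with an eigenbasis and their square roots\<close>

lemma self_adjoint_symmetric:
  assumes "self_adjoint C" "(x, y) \<in> C" "(u, v) \<in> C"
  shows "y \<bullet> u = x \<bullet> v"
proof -
  have "(u, v) \<in> adjoint_operator C"
    using assms by (simp add: self_adjoint_def)
  then show ?thesis
    using assms(2) by (auto simp: adjoint_operator_def)
qed

text \<open>No summability condition on \<open>u\<close> is imposed: that \<open>v\<close> is a vector with coefficients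
  \<open>s i * (u \<bullet> b i)\<close> already forces their squares to be summable, so this is the maximal domain.\<close>

definition (in hilbert_basis) diagonal_operator :: "(nat \<Rightarrow> real) \<Rightarrow> ('a \<times> 'a) set" where
  "diagonal_operator s = {(u, v). \<forall>i. v \<bullet> b i = s i * (u \<bullet> b i)}"

context hilbert_basis
begin

lemma basis_in_diagonal_operator: "(b i, s i *\<^sub>R b i) \<in> diagonal_operator s"
  by (auto simp: diagonal_operator_def orthonormal)

lemma diagonal_operator_symmetric:
  assumes "(x, y) \<in> diagonal_operator s" "(u, v) \<in> diagonal_operator s"
  shows "y \<bullet> u = x \<bullet> v"
proof -
  have "(y \<bullet> b i) * (u \<bullet> b i) = (x \<bullet> b i) * (v \<bullet> b i)" for i
    using assms by (simp add: diagonal_operator_def)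
  then show ?thesis
    using parseval[of y u] parseval[of x v] sums_unique2 by simp
qed

lemma self_adjoint_diagonal_operator: "self_adjoint (diagonal_operator s)"
proof -
  let ?D = "diagonal_operator s"
  have sub: "subspace ?D"
    by (auto simp: subspace_def diagonal_operator_def inner_add_left algebra_simps zero_prod_def)
  have "single_valued ?D"
    by (auto simp: single_valued_def diagonal_operator_def intro!: eqI)
  moreover have "x \<in> closure (Domain ?D)" for x
  proof -
    have "(\<Sum>i<N. c i *\<^sub>R b i) \<in> Domain ?D" for N c
    proof -
      have "(\<Sum>i<N. c i *\<^sub>R (b i, s i *\<^sub>R b i)) \<in> ?D"
        by (intro subspace_sum sub subspace_scale basis_in_diagonal_operator)
      then have "fst (\<Sum>i<N. c i *\<^sub>R (b i, s i *\<^sub>R b i)) \<in> Domain ?D"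
        by (metis Domain.DomainI prod.collapse)
      then show ?thesis
        by (simp add: fst_sum)
    qed
    then show ?thesis
      unfolding closure_sequential using fourier_sums[of x]
      by (intro exI[of _ "\<lambda>N. \<Sum>i<N. (x \<bullet> b i) *\<^sub>R b i"]) (simp add: sums_def)
  qed
  moreover have "adjoint_operator ?D = ?D"
  proof (intro equalityI subrelI)
    fix v w assume "(v, w) \<in> adjoint_operator ?D"
    then have *: "y \<bullet> v = x \<bullet> w" if "(x, y) \<in> ?D" for x y
      using that by (auto simp: adjoint_operator_def)
    have "w \<bullet> b i = s i * (v \<bullet> b i)" for i
      using *[OF basis_in_diagonal_operator, of i] by (simp add: inner_commute)
    then show "(v, w) \<in> ?D"
      by (simp add: diagonal_operator_def)
  qed (auto simp: adjoint_operator_def dest: diagonal_operator_symmetric)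
  ultimately show ?thesis
    using sub by (auto simp: self_adjoint_def linear_operator_def)
qed

text \<open>Symmetry against the eigenvectors forces \<open>C\<close> into the diagonal operator. The latter is symmetric,
  hence contained in the adjoint of its restriction \<open>C\<close>, which is \<open>C\<close> again.\<close>

lemma self_adjoint_eq_diagonal_operator:
  assumes C: "self_adjoint C" and b: "\<And>i. (b i, s i *\<^sub>R b i) \<in> C"
  shows "C = diagonal_operator s"
proof -
  have sub: "C \<subseteq> diagonal_operator s"
  proof (rule subrelI)
    fix u v assume "(u, v) \<in> C"
    then show "(u, v) \<in> diagonal_operator s"
      using self_adjoint_symmetric[OF C _ b] by (auto simp: diagonal_operator_def)
  qed
  moreover have "diagonal_operator s \<subseteq> adjoint_operator C"
    using sub by (auto simp: adjoint_operator_def dest: diagonal_operator_symmetric)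
  ultimately show ?thesis
    using C by (auto simp: self_adjoint_def)
qed

text \<open>The root is \<open>diagonal_operator (\<lambda>i. sqrt (L i))\<close>. For uniqueness, let \<open>C\<close> be another one, put
  \<open>s = sqrt (L i)\<close> and \<open>w = C (b i)\<close>, so that \<open>C w = s\<^sup>2 b i\<close>. Then \<open>z = w - s b i\<close> satisfies
  \<open>C z = - s z\<close>, which for \<open>s > 0\<close> contradicts nonnegativity unless \<open>z = 0\<close>, while for \<open>s = 0\<close>
  the symmetry of \<open>C\<close> gives \<open>w \<bullet> w = b i \<bullet> C w = 0\<close>. So \<open>C\<close> is diagonal with the same entries.\<close>

lemma op_sqrt_eq_diagonal_operator:
  assumes A: "self_adjoint A" and b: "\<And>i. (b i, L i *\<^sub>R b i) \<in> A" and L: "\<And>i. L i \<ge> 0"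
  shows "op_sqrt A = diagonal_operator (\<lambda>i. sqrt (L i))"
  unfolding op_sqrt_def
proof (rule the_equality, intro conjI)
  let ?B = "diagonal_operator (\<lambda>i. sqrt (L i))"
  show "self_adjoint ?B"
    by (rule self_adjoint_diagonal_operator)
  show "nonneg_operator ?B"
    unfolding nonneg_operator_def
  proof clarify
    fix u v assume uv: "(u, v) \<in> ?B"
    have "0 \<le> (v \<bullet> b i) * (u \<bullet> b i)" for i
      using uv L[of i] by (simp add: diagonal_operator_def mult.assoc)
    then show "0 \<le> v \<bullet> u"
      by (rule sums_le[OF _ sums_zero parseval])
  qed
  have A_eq: "A = diagonal_operator L"
    using A b by (rule self_adjoint_eq_diagonal_operator)
  have sq: "sqrt (L i) * (sqrt (L i) * c) = L i * c" for i c
    using L[of i] by (simp flip: mult.assoc)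
  show "?B O ?B = A"
  proof (intro equalityI subrelI)
    fix u v assume "(u, v) \<in> ?B O ?B"
    then show "(u, v) \<in> A"
      by (auto simp: A_eq diagonal_operator_def sq)
  next
    fix u v assume "(u, v) \<in> A"
    then have v: "v \<bullet> b i = L i * (u \<bullet> b i)" for i
      by (simp add: A_eq diagonal_operator_def)
    have "summable (\<lambda>i. (sqrt (L i) * (u \<bullet> b i))\<^sup>2)"
    proof (rule sums_summable)
      show "(\<lambda>i. (sqrt (L i) * (u \<bullet> b i))\<^sup>2) sums (v \<bullet> u)"
        using parseval[of v u] L by (simp add: v power_mult_distrib) (simp add: power2_eq_square mult.assoc)
    qed
    from riesz_fischer[OF this]
    obtain w where "\<And>i. w \<bullet> b i = sqrt (L i) * (u \<bullet> b i)"
      by metis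
    then have "(u, w) \<in> ?B" "(w, v) \<in> ?B"
      by (simp_all add: diagonal_operator_def sq v)
    then show "(u, v) \<in> ?B O ?B" by blast
  qed
  fix C assume C: "self_adjoint C \<and> nonneg_operator C \<and> C O C = A"
  then have subspace: "subspace C"
    by (simp add: self_adjoint_def linear_operator_def)
  have "(b i, sqrt (L i) *\<^sub>R b i) \<in> C" for i
  proof -
    let ?s = "sqrt (L i)"
    obtain w where w: "(b i, w) \<in> C" "(w, L i *\<^sub>R b i) \<in> C"
      using C b[of i] by blast
    show ?thesis
    proof (cases "?s = 0")
      case True
      then have "w \<bullet> w = 0"
        using self_adjoint_symmetric[of C "b i" w w "L i *\<^sub>R b i"] C w by simp
      then show ?thesis
        using w True by simp
    next
      case False
      define z where "z = w - ?s *\<^sub>R b i"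
      have "(w, L i *\<^sub>R b i) - ?s *\<^sub>R (b i, w) \<in> C"
        by (intro subspace_diff subspace_scale subspace w)
      moreover have "L i *\<^sub>R b i - ?s *\<^sub>R w = (- ?s) *\<^sub>R z"
        using L[of i] by (simp add: z_def algebra_simps)
      ultimately have "(z, (- ?s) *\<^sub>R z) \<in> C"
        by (simp add: z_def)
      then have "0 \<le> ((- ?s) *\<^sub>R z) \<bullet> z"
        using C unfolding nonneg_operator_def by fast
      moreover have "?s > 0"
        using False L[of i] by simp
      ultimately have "z \<bullet> z \<le> 0"
        by (simp add: mult_le_0_iff zero_le_mult_iff)
      then have "w = ?s *\<^sub>R b i"
        by (metis z_def inner_eq_zero_iff inner_ge_zero order_antisym right_minus_eq)
      then show ?thesis
        using w by simp
    qed
  qed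
  then show "C = ?B"
    using C self_adjoint_eq_diagonal_operator[of C "\<lambda>i. sqrt (L i)"] by blast
qed

end

section \<open>Nehari--Pankov sets of indefinite functionals\<close>

text \<open>The energy space splits orthogonally into \<open>V = span (b ` {..<n})\<close>, where \<open>q\<close> is negative
  definite, and its complement, where \<open>q\<close> is coercive; the two parts are also \<open>q\<close>-orthogonal.
  Membership in the complement is spelled out as the vanishing of the first \<open>n\<close> coefficients.\<close>

locale indefinite_functional = hilbert_basis b
  for b :: "nat \<Rightarrow> 'e::{real_inner, complete_space}" +
  fixes q :: "'e \<Rightarrow> 'e \<Rightarrow> real" and n :: nat and \<delta> :: real
    and I :: "'e \<Rightarrow> real" and I' :: "'e \<Rightarrow> 'e \<Rightarrow>\<^sub>L real"
  assumes q_bounded_bilinear: "bounded_bilinear q"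
    and q_sym: "q u v = q v u"
    and q_neg: "v \<in> span (b ` {..<n}) \<Longrightarrow> v \<noteq> 0 \<Longrightarrow> q v v < 0"
    and q_orth: "v \<in> span (b ` {..<n}) \<Longrightarrow> (\<And>i. i < n \<Longrightarrow> w \<bullet> b i = 0) \<Longrightarrow> q v w = 0"
    and \<delta>_pos: "\<delta> > 0"
    and q_coercive: "(\<And>i. i < n \<Longrightarrow> w \<bullet> b i = 0) \<Longrightarrow> \<delta> * (norm w)\<^sup>2 \<le> q w w"
    and I_deriv: "(I has_derivative blinfun_apply (I' u)) (at u)"
    and I_C1: "continuous_on UNIV I'"
    and I_zero: "I 0 = 0"
    and I_weak: "weakly_converges x u \<Longrightarrow> (\<lambda>k. I (x k)) \<longlonglongrightarrow> I u"
    and I_pos: "u \<noteq> 0 \<Longrightarrow> I u > 0"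
    and I_mono: "u \<noteq> 0 \<Longrightarrow> mono_on {0<..} (\<lambda>t. I (t *\<^sub>R u) / t\<^sup>2)"
    and I_lim_0: "u \<noteq> 0 \<Longrightarrow> ((\<lambda>t. I (t *\<^sub>R u) / t\<^sup>2) \<longlongrightarrow> 0) (at_right 0)"
    and I_lim_inf: "u \<noteq> 0 \<Longrightarrow> filterlim (\<lambda>t. I (t *\<^sub>R u) / t\<^sup>2) at_top at_top"
    and I_ineq: "u \<noteq> 0 \<Longrightarrow> s \<ge> -1 \<Longrightarrow>
        I u - I ((1 + s) *\<^sub>R u + v)
          + blinfun_apply (I' u) ((s * (s / 2 + 1)) *\<^sub>R u + (1 + s) *\<^sub>R v) \<le> 0"
    and I_strict: "u \<noteq> 0 \<Longrightarrow> s \<ge> -1 \<Longrightarrow> s \<noteq> 0 \<Longrightarrow>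
        I u - I ((1 + s) *\<^sub>R u) + blinfun_apply (I' u) ((s * (s / 2 + 1)) *\<^sub>R u) < 0"
begin

sublocale q: bounded_bilinear q
  by (rule q_bounded_bilinear)

abbreviation V :: "'e set" where
  "V \<equiv> span (b ` {..<n})"

definition proj :: "'e \<Rightarrow> 'e" where
  "proj u = (\<Sum>i<n. (u \<bullet> b i) *\<^sub>R b i)"

definition J :: "'e \<Rightarrow> real" where
  "J u = q u u / 2 - I u"

definition dJ :: "'e \<Rightarrow> 'e \<Rightarrow> real" where
  "dJ u w = q u w - blinfun_apply (I' u) w"

definition NP :: "'e set" where
  "NP = {u. u \<notin> V \<and> (\<forall>v\<in>V. \<forall>t. dJ u (v + t *\<^sub>R u) = 0)}"

lemma proj_in_V: "proj u \<in> V"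
  unfolding proj_def by (intro span_sum span_scale span_base) auto

lemma minus_proj_perp: "i < n \<Longrightarrow> (u - proj u) \<bullet> b i = 0"
  by (simp add: proj_def inner_diff_left inner_finite_sum)

lemma V_perp_eq_0: "w = 0" if "w \<in> V" "\<And>i. i < n \<Longrightarrow> w \<bullet> b i = 0"
proof -
  have "\<delta> * (norm w)\<^sup>2 \<le> 0"
    using q_coercive[of w] q_orth[of w w] that by simp
  then show ?thesis
    using \<delta>_pos by (simp add: mult_le_0_iff)
qed

lemma J_has_derivative: "(J has_derivative dJ u) (at u)"
proof -
  have "((\<lambda>x. q x x) has_derivative (\<lambda>h. q u h + q h u)) (at u)"
    by (intro q.FDERIV derivative_intros)
  then have "((\<lambda>x. 1/2 * q x x - I x) has_derivative
      (\<lambda>h. 1/2 * (q u h + q h u) - blinfun_apply (I' u) h)) (at u)"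
    by (intro has_derivative_diff has_derivative_mult_right I_deriv)
  then show ?thesis
    by (simp add: J_def[abs_def] dJ_def[abs_def] q_sym[of _ u])
qed

lemma J_line_has_derivative:
  "((\<lambda>h. J (x + h *\<^sub>R w)) has_real_derivative dJ (x + h *\<^sub>R w) w) (at h)"
proof -
  have "((\<lambda>h. x + h *\<^sub>R w) has_derivative (\<lambda>h. h *\<^sub>R w)) (at h)"
    by (auto intro!: derivative_eq_intros)
  then have "((\<lambda>h. J (x + h *\<^sub>R w)) has_derivative (\<lambda>s. dJ (x + h *\<^sub>R w) (s *\<^sub>R w))) (at h)"
    using J_has_derivative by (rule has_derivative_compose)
  then show ?thesis
    by (simp add: has_field_derivative_def mult_commute_abs
        linear_scale[OF has_derivative_linear[OF J_has_derivative]])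
qed

lemma tendsto_J: "(f \<longlongrightarrow> l) F \<Longrightarrow> ((\<lambda>x. J (f x)) \<longlongrightarrow> J l) F"
  using J_has_derivative has_derivative_continuous isCont_tendsto_compose by blast

lemma J_nonpos_on_V: "J v \<le> 0" if "v \<in> V"
  using q_neg[OF that] I_pos[of v] by (cases "v = 0") (auto simp: J_def I_zero q.zero_left)

text \<open>The case \<open>s = -1\<close>, \<open>v = 0\<close> of \<open>I_ineq\<close>.\<close>

lemma I_deriv_self_ge: "2 * I u \<le> blinfun_apply (I' u) u" if "u \<noteq> 0"
  using I_ineq[OF that, of "-1" 0] by (simp add: I_zero blinfun.minus_right blinfun.scaleR_right)

text \<open>A critical point in \<open>V\<close> would satisfy \<open>0 > q u u = I' u u \<ge> 2 * I u > 0\<close>.\<close>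

lemma critical_imp_NP: "u \<in> NP" if "u \<noteq> 0" "\<And>w. dJ u w = 0"
proof -
  have "u \<notin> V"
  proof
    assume "u \<in> V"
    then have "q u u < 0"
      using q_neg that by blast
    then show False
      using that(2)[of u] I_deriv_self_ge[OF that(1)] I_pos[OF that(1)] by (simp add: dJ_def)
  qed
  then show ?thesis
    using that by (simp add: NP_def)
qed

text \<open>The role of \<open>I_ineq\<close>. With \<open>s = t - 1\<close>, expanding \<open>q\<close> gives
  \<open>J (t u + v) - J u = q u z + q v v / 2 + I u - I (t u + v)\<close> for
  \<open>z = s (s / 2 + 1) u + t v\<close>. Since \<open>z\<close> lies in the span of \<open>V\<close> and \<open>u\<close>, the constraint
  replaces \<open>q u z\<close> by \<open>I' u z\<close>, and what remains besides \<open>q v v / 2 \<le> 0\<close> is precisely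
  the expression in \<open>I_ineq\<close>. So a point of \<open>NP\<close> is the unique global maximizer of \<open>J\<close> on its
  closed half-space.\<close>

lemma NP_maximal:
  assumes u: "u \<in> NP" and t: "t \<ge> 0" and v: "v \<in> V" and ne: "\<not> (t = 1 \<and> v = 0)"
  shows "J (t *\<^sub>R u + v) < J u"
proof -
  have "u \<noteq> 0"
    using u span_zero by (auto simp: NP_def)
  define s where "s = t - 1"
  define z where "z = (s * (s / 2 + 1)) *\<^sub>R u + t *\<^sub>R v"
  have "dJ u (t *\<^sub>R v + (s * (s / 2 + 1)) *\<^sub>R u) = 0"
    using u v by (auto simp: NP_def intro: span_scale)
  then have z: "q u z = blinfun_apply (I' u) z"
    by (simp add: dJ_def z_def add.commute)
  have "J (t *\<^sub>R u + v) - J u = q u z + q v v / 2 - I (t *\<^sub>R u + v) + I u"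
    unfolding J_def z_def s_def
    by (simp add: q.add_left q.add_right q.scaleR_left q.scaleR_right q_sym[of v u] field_simps)
  also have "\<dots> = q v v / 2 + (I u - I ((1 + s) *\<^sub>R u + v)
      + blinfun_apply (I' u) ((s * (s / 2 + 1)) *\<^sub>R u + (1 + s) *\<^sub>R v))"
    unfolding z by (simp add: z_def s_def)
  also have "\<dots> < 0"
  proof (cases "v = 0")
    case True
    then show ?thesis
      using I_strict[OF \<open>u \<noteq> 0\<close>, of s] ne t by (simp add: s_def q.zero_left)
  next
    case False
    then show ?thesis
      using I_ineq[OF \<open>u \<noteq> 0\<close>, of s v] q_neg[OF v] t by (simp add: s_def)
  qed
  finally show ?thesis by simp
qed

lemma NP_maximal_le: "J (t *\<^sub>R u + v) \<le> J u" if "u \<in> NP" "t \<ge> 0" "v \<in> V"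
  using NP_maximal[OF that] by (cases "t = 1 \<and> v = 0") auto

lemma J_NP_pos: "J u > 0" if "u \<in> NP"
  using NP_maximal[OF that, of 0 0] by (simp add: J_def I_zero q.zero_left span_zero)

text \<open>Divide \<open>J (r j y j) \<ge> 0\<close> by \<open>(r j)\<^sup>2\<close>: monotonicity of \<open>t \<mapsto> I (t y) / t\<^sup>2\<close> bounds
  \<open>I (s y j) / s\<^sup>2\<close> by \<open>q (y j) (y j) / 2\<close> for each fixed \<open>s\<close> as soon as \<open>r j \<ge> s\<close>. In the limit
  \<open>I (s y0) / s\<^sup>2\<close> would be bounded in \<open>s\<close>, although \<open>I\<close> is superquadratic.\<close>

lemma J_nonneg_no_escape:
  assumes y: "y \<longlonglongrightarrow> y0" "y0 \<noteq> 0" and r: "filterlim r at_top sequentially"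
    and J: "\<And>j. J (r j *\<^sub>R y j) \<ge> 0"
  shows False
proof -
  have "I (s *\<^sub>R y0) / s\<^sup>2 \<le> q y0 y0 / 2" if s: "s > 0" for s
  proof (rule tendsto_le)
    show "(\<lambda>j. q (y j) (y j) / 2) \<longlonglongrightarrow> q y0 y0 / 2"
      by (intro tendsto_intros q.tendsto y) auto
    have "(\<lambda>j. I (s *\<^sub>R y j)) \<longlonglongrightarrow> I (s *\<^sub>R y0)"
      using I_deriv has_derivative_continuous isCont_tendsto_compose
      by (blast intro: tendsto_scaleR tendsto_const y)
    then show "(\<lambda>j. I (s *\<^sub>R y j) / s\<^sup>2) \<longlonglongrightarrow> I (s *\<^sub>R y0) / s\<^sup>2"
      using s by (intro tendsto_divide tendsto_const) auto
    have "eventually (\<lambda>j. r j \<ge> s) sequentially"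
      using r by (simp add: filterlim_at_top)
    then show "eventually (\<lambda>j. I (s *\<^sub>R y j) / s\<^sup>2 \<le> q (y j) (y j) / 2) sequentially"
    proof eventually_elim
      case (elim j)
      have "r j > 0" using elim s by simp
      have "I (s *\<^sub>R y j) / s\<^sup>2 \<le> I (r j *\<^sub>R y j) / (r j)\<^sup>2"
      proof (cases "y j = 0")
        case False
        show ?thesis
          using mono_onD[OF I_mono[OF False], of s "r j"] elim s by simp
      qed (simp add: I_zero)
      also have "\<dots> \<le> q (y j) (y j) / 2"
        using J[of j] \<open>r j > 0\<close>
        by (simp add: J_def q.scaleR_left q.scaleR_right field_simps power2_eq_square)
      finally show ?case .
    qed
  qed auto
  moreover have "eventually (\<lambda>s. I (s *\<^sub>R y0) / s\<^sup>2 > q y0 y0 / 2) at_top"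
    using I_lim_inf[OF y(2)] unfolding filterlim_at_top_dense by blast
  then obtain s where "s > 0" "I (s *\<^sub>R y0) / s\<^sup>2 > q y0 y0 / 2"
    using eventually_happens[OF eventually_conj[OF _ eventually_gt_at_top[of 0]]] by force
  ultimately show False by force
qed

lemma compact_V_cball: "compact (V \<inter> cball 0 R)"
proof (rule compact_span_cball)
  fix x y assume "x \<in> b ` {..<n}" "y \<in> b ` {..<n}"
  then obtain i j where "x = b i" "y = b j" by blast
  moreover have "b i = b j \<longleftrightarrow> i = j"
    using orthonormal[of i j] orthonormal[of i i] by (auto split: if_splits)
  ultimately show "x \<bullet> y = (if x = y then 1 else 0)"
    by (simp add: orthonormal)
qed auto

text \<open>Bolzano--Weierstrass for the coordinates \<open>(t, v)\<close> of points in a half-space.\<close>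

lemma half_space_pairs_subsequence:
  assumes "\<And>j. t j \<in> {0..R}" "\<And>j. v j \<in> V \<inter> cball 0 R"
  obtains l :: "nat \<Rightarrow> nat" and t0 v0 where "strict_mono l" "t0 \<ge> 0" "v0 \<in> V"
    "(\<lambda>j. t (l j)) \<longlonglongrightarrow> t0" "(\<lambda>j. v (l j)) \<longlonglongrightarrow> v0"
proof -
  have "seq_compact ({0..R} \<times> (V \<inter> cball 0 R))"
    by (intro compact_imp_seq_compact compact_Times compact_V_cball compact_Icc)
  moreover have "\<forall>j. (t j, v j) \<in> {0..R} \<times> (V \<inter> cball 0 R)"
    using assms by blast
  ultimately obtain p l where p: "p \<in> {0..R} \<times> (V \<inter> cball 0 R)" and l: "strict_mono l"
    and lim: "((\<lambda>j. (t j, v j)) \<circ> l) \<longlonglongrightarrow> p"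
    by (rule seq_compactE)
  show ?thesis
    using that[OF l, of "fst p" "snd p"] p tendsto_fst[OF lim] tendsto_snd[OF lim]
    by (auto simp: o_def)
qed

text \<open>The points \<open>t j u j + v j\<close> live in half-spaces that vary with \<open>j\<close>, but only finitely many
  coordinates are involved. If \<open>t j + norm (v j)\<close> were unbounded, dividing by it along a subsequence
  would produce convergent directions, with a limit that is nonzero because \<open>u0 \<notin> V\<close>; this is
  excluded by \<open>J_nonneg_no_escape\<close>. The varying \<open>u\<close> is needed for \<open>minimizer_critical\<close>;
  for a constant \<open>u\<close> the lemma gives the compactness behind \<open>half_space_meets_NP\<close>.\<close>

lemma superlevel_half_spaces_precompact:
  assumes u: "u \<longlonglongrightarrow> u0" "u0 \<notin> V" and t: "\<And>j. t j \<ge> 0" and v: "\<And>j. v j \<in> V"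
    and J: "\<And>j. J (t j *\<^sub>R u j + v j) \<ge> 0"
  obtains l :: "nat \<Rightarrow> nat" and t0 v0 where "strict_mono l" "t0 \<ge> 0" "v0 \<in> V"
    "(\<lambda>j. t (l j)) \<longlonglongrightarrow> t0" "(\<lambda>j. v (l j)) \<longlonglongrightarrow> v0"
proof -
  define r where "r j = t j + norm (v j)" for j
  have r0: "r j \<ge> 0" for j
    using t[of j] by (simp add: r_def)
  have "Bseq r"
  proof (rule ccontr)
    assume nb: "\<not> Bseq r"
    have "\<exists>k\<ge>j. r k \<ge> real (Suc j)" for j
    proof (rule ccontr)
      assume "\<not> ?thesis"
      then have "norm (r (k + j)) \<le> real (Suc j)" for k
        using r0[of "k + j"] by (metis abs_of_nonneg le_add2 nle_le real_norm_def)
      then have "Bseq (\<lambda>k. r (k + j))"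
        by (rule BseqI')
      then show False
        using nb Bseq_offset by blast
    qed
    then obtain k where k: "\<And>j. k j \<ge> j" "\<And>j. r (k j) \<ge> real (Suc j)"
      by metis
    have rk: "r (k j) > 0" for j
      using k(2)[of j] by linarith
    define a where "a j = t (k j) / r (k j)" for j
    define c where "c j = v (k j) /\<^sub>R r (k j)" for j
    have "a j \<in> {0..1}" for j
      using rk[of j] t[of "k j"] by (simp add: a_def r_def)
    moreover have "c j \<in> V \<inter> cball 0 1" for j
      using rk[of j] t[of "k j"] v by (simp add: c_def r_def span_scale field_simps)
    ultimately obtain l :: "nat \<Rightarrow> nat" and a0 c0 where l: "strict_mono l" and "a0 \<ge> 0" "c0 \<in> V"
      and lim: "(\<lambda>j. a (l j)) \<longlonglongrightarrow> a0" "(\<lambda>j. c (l j)) \<longlonglongrightarrow> c0"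
      by (rule half_space_pairs_subsequence)
    have "a j + norm (c j) = 1" for j
      using rk[of j] by (simp add: a_def c_def r_def divide_inverse_commute flip: distrib_left)
    then have "(\<lambda>j. 1) \<longlonglongrightarrow> a0 + norm c0"
      using tendsto_add[OF lim(1) tendsto_norm[OF lim(2)]] by simp
    then have ac: "a0 + norm c0 = 1"
      by (simp add: LIMSEQ_const_iff)
    have kl: "filterlim (\<lambda>j. k (l j)) at_top sequentially"
      unfolding filterlim_at_top eventually_sequentially
      by (meson k(1) l order_trans seq_suble)
    have "filterlim (\<lambda>j. r (k (l j))) at_top sequentially"
    proof (rule filterlim_at_top_mono[OF filterlim_real_sequentially])
      show "\<forall>\<^sub>F j in sequentially. real j \<le> r (k (l j))"
        using k(2) seq_suble[OF l] by (intro always_eventually allI) (smt (verit) of_nat_Suc of_nat_mono)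
    qed
    moreover have "(\<lambda>j. a (l j) *\<^sub>R u (k (l j)) + c (l j)) \<longlonglongrightarrow> a0 *\<^sub>R u0 + c0"
      using filterlim_compose[OF u(1) kl] by (intro tendsto_intros lim)
    moreover have "a0 *\<^sub>R u0 + c0 \<noteq> 0"
    proof
      assume *: "a0 *\<^sub>R u0 + c0 = 0"
      show False
      proof (cases "a0 = 0")
        case True
        then show False using * ac by simp
      next
        case False
        have "(1 / a0) *\<^sub>R (a0 *\<^sub>R u0 + c0) = 0"
          using * by simp
        then have "u0 = - ((1 / a0) *\<^sub>R c0)"
          using False by (simp add: scaleR_add_right eq_neg_iff_add_eq_0)
        then show False
          using u(2) \<open>c0 \<in> V\<close> by (simp add: span_neg span_scale)
      qed
    qed
    moreover have "J (r (k (l j)) *\<^sub>R (a (l j) *\<^sub>R u (k (l j)) + c (l j))) \<ge> 0" for j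
      using J[of "k (l j)"] rk[of "l j"] by (simp add: a_def c_def scaleR_add_right)
    ultimately show False
      using J_nonneg_no_escape by blast
  qed
  then obtain R where R: "\<And>j. r j \<le> R"
    unfolding Bseq_def by (metis abs_le_D1 real_norm_def)
  have "t j \<in> {0..R}" "v j \<in> V \<inter> cball 0 R" for j
    using t[of j] v[of j] R[of j] norm_ge_zero[of "v j"] by (auto simp: r_def simp del: norm_ge_zero)
  then show ?thesis
    using half_space_pairs_subsequence that by metis
qed


lemma perp_not_in_V: "w \<notin> V" if "w \<noteq> 0" "\<And>i. i < n \<Longrightarrow> w \<bullet> b i = 0"
  using that V_perp_eq_0 by blast

text \<open>A maximum over the open half-space is a critical point of \<open>J\<close> restricted to the span of \<open>V\<close> and
  \<open>u\<close>, because the open half-space is open in that span.\<close>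

lemma NP_I:
  assumes m: "m = t *\<^sub>R u + v" and u: "u \<notin> V" and t: "t > 0" and v: "v \<in> V"
    and max: "\<And>t v. t > 0 \<Longrightarrow> v \<in> V \<Longrightarrow> J (t *\<^sub>R u + v) \<le> J m"
  shows "m \<in> NP"
proof -
  have "m \<notin> V"
  proof
    assume "m \<in> V"
    then have "(1 / t) *\<^sub>R (m - v) \<in> V"
      using v by (intro span_scale span_diff)
    then show False
      using u t by (simp add: m)
  qed
  moreover have "dJ m (v' + s *\<^sub>R m) = 0" if v': "v' \<in> V" for v' s
  proof (rule DERIV_local_max)
    let ?w = "v' + s *\<^sub>R m"
    show "DERIV (\<lambda>h. J (m + h *\<^sub>R ?w)) 0 :> dJ m ?w"
      using J_line_has_derivative[of m ?w 0] by simp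
    \<comment> \<open>the coefficient of \<open>u\<close> in \<open>m + h *\<^sub>R ?w\<close> is \<open>t * (1 + h * s)\<close>, positive for such \<open>h\<close>\<close>
    show "0 < 1 / (\<bar>s\<bar> + 1)" by simp
    show "\<forall>h. \<bar>0 - h\<bar> < 1 / (\<bar>s\<bar> + 1) \<longrightarrow> J (m + h *\<^sub>R ?w) \<le> J (m + 0 *\<^sub>R ?w)"
    proof (intro allI impI)
      fix h assume "\<bar>0 - h\<bar> < 1 / (\<bar>s\<bar> + 1)"
      then have "\<bar>h\<bar> * (\<bar>s\<bar> + 1) < 1"
        by (simp add: pos_less_divide_eq)
      then have "\<bar>h * s\<bar> < 1"
        unfolding abs_mult by (smt (verit) abs_ge_zero mult_left_mono)
      then have "t * (1 + h * s) > 0"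
        using t by simp
      moreover have "(1 + h * s) *\<^sub>R v + h *\<^sub>R v' \<in> V"
        using v v' by (intro span_add span_scale)
      moreover have "m + h *\<^sub>R ?w = (t * (1 + h * s)) *\<^sub>R u + ((1 + h * s) *\<^sub>R v + h *\<^sub>R v')"
        by (simp add: m algebra_simps)
      ultimately show "J (m + h *\<^sub>R ?w) \<le> J (m + 0 *\<^sub>R ?w)"
        using max by simp
    qed
  qed
  ultimately show ?thesis
    by (simp add: NP_def)
qed

lemma exists_J_pos: "\<exists>t>0. J (t *\<^sub>R w) > 0" if "w \<noteq> 0" "\<And>i. i < n \<Longrightarrow> w \<bullet> b i = 0"
proof -
  have "q w w > 0"
    using q_coercive[of w] that \<delta>_pos by (smt (verit) mult_pos_pos zero_less_norm_iff zero_less_power)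
  then have "eventually (\<lambda>t. I (t *\<^sub>R w) / t\<^sup>2 < q w w / 2) (at_right 0)"
    using order_tendstoD(2)[OF I_lim_0[OF that(1)], of "q w w / 2"] by simp
  then obtain d where "d > 0" "\<And>t. t > 0 \<Longrightarrow> t < d \<Longrightarrow> I (t *\<^sub>R w) / t\<^sup>2 < q w w / 2"
    unfolding eventually_at_right_field by blast
  then have "d / 2 > 0" "I ((d / 2) *\<^sub>R w) / (d / 2)\<^sup>2 < q w w / 2"
    by auto
  then have "I ((d / 2) *\<^sub>R w) < q w w / 2 * (d / 2)\<^sup>2"
    by (subst (asm) pos_divide_less_eq) auto
  then have "J ((d / 2) *\<^sub>R w) > 0"
    by (simp add: J_def q.scaleR_left q.scaleR_right power2_eq_square mult.commute mult.left_commute)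
  then show ?thesis
    using \<open>d / 2 > 0\<close> by blast
qed

text \<open>The part of the closed half-space where \<open>J \<ge> 0\<close> is compact, so \<open>J\<close> has a maximum \<open>m\<close> over the
  closed half-space. It does not lie on the boundary \<open>V\<close>, where \<open>J \<le> 0\<close>, since \<open>J\<close> is positive at small
  multiples of the component of \<open>u\<close> orthogonal to \<open>V\<close>.\<close>

lemma half_space_meets_NP:
  assumes u: "u \<notin> V"
  obtains t v where "t > 0" "v \<in> V" "t *\<^sub>R u + v \<in> NP"
proof -
  define C where "C = {t *\<^sub>R u + v | t v. t \<ge> 0 \<and> v \<in> V \<and> J (t *\<^sub>R u + v) \<ge> 0}"
  have "seq_compact C"
  proof (rule seq_compactI)
    fix x :: "nat \<Rightarrow> 'e" assume "\<forall>j. x j \<in> C"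
    then obtain t v where x: "\<And>j. x j = t j *\<^sub>R u + v j"
      and t: "\<And>j. t j \<ge> 0" and v: "\<And>j. v j \<in> V" and J: "\<And>j. J (t j *\<^sub>R u + v j) \<ge> 0"
      unfolding C_def mem_Collect_eq by metis
    obtain l :: "nat \<Rightarrow> nat" and t0 v0 where l: "strict_mono l" "t0 \<ge> 0" "v0 \<in> V"
      and lim: "(\<lambda>j. t (l j)) \<longlonglongrightarrow> t0" "(\<lambda>j. v (l j)) \<longlonglongrightarrow> v0"
      by (rule superlevel_half_spaces_precompact[OF tendsto_const u t v J])
    have x_lim: "(\<lambda>j. x (l j)) \<longlonglongrightarrow> t0 *\<^sub>R u + v0"
      unfolding x by (intro tendsto_intros lim)
    have "J (t0 *\<^sub>R u + v0) \<ge> 0"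
      using tendsto_J[OF x_lim] by (rule LIMSEQ_le_const) (use J x in auto)
    then show "\<exists>y\<in>C. \<exists>l. strict_mono l \<and> (x \<circ> l) \<longlonglongrightarrow> y"
      using l x_lim by (intro bexI[of _ "t0 *\<^sub>R u + v0"] exI[of _ l]) (auto simp: C_def o_def)
  qed
  then have "compact C"
    by (simp add: compact_eq_seq_compact_metric)
  moreover have "0 *\<^sub>R u + 0 \<in> C"
    unfolding C_def using span_zero by (fastforce simp: J_def I_zero q.zero_left)
  moreover have "continuous_on C J"
    using J_has_derivative by (meson continuous_at_imp_continuous_on has_derivative_continuous)
  ultimately obtain m where m: "m \<in> C" "\<And>x. x \<in> C \<Longrightarrow> J x \<le> J m"
    using continuous_attains_sup[of C J] by blast
  then obtain t v where tv: "m = t *\<^sub>R u + v" "t \<ge> 0" "v \<in> V" "J m \<ge> 0"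
    by (auto simp: C_def)
  have max: "J (t' *\<^sub>R u + v') \<le> J m" if "t' \<ge> 0" "v' \<in> V" for t' v'
    using m(2)[of "t' *\<^sub>R u + v'"] that tv(4) by (cases "J (t' *\<^sub>R u + v') \<ge> 0") (auto simp: C_def)
  let ?w = "u - proj u"
  have "?w \<noteq> 0"
    using u proj_in_V[of u] by auto
  then obtain a where a: "a > 0" "J (a *\<^sub>R ?w) > 0"
    using exists_J_pos[of ?w] minus_proj_perp by blast
  have "a *\<^sub>R ?w = a *\<^sub>R u + (- a) *\<^sub>R proj u"
    by (simp add: algebra_simps)
  moreover have "(- a) *\<^sub>R proj u \<in> V"
    by (intro span_scale proj_in_V)
  ultimately have "J m > 0"
    using max[of a "(- a) *\<^sub>R proj u"] a by simp
  then have "t \<noteq> 0"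
    using J_nonpos_on_V[OF tv(3)] tv(1) by auto
  then show ?thesis
    using that[of t v] NP_I[OF tv(1) u _ tv(3)] max tv by force
qed

text \<open>Let \<open>u j\<close> be a minimizing sequence and \<open>z j\<close> the normalized component of \<open>u j\<close> orthogonal to
  \<open>V\<close>. Both span the same half-space, so \<open>J (t z j + v) \<le> J (u j)\<close> for all \<open>t \<ge> 0\<close> and \<open>v \<in> V\<close>.
  Let \<open>z0\<close> be a weak limit of the unit vectors \<open>z j\<close>. If \<open>z0 = 0\<close>, then \<open>I (t z j) \<rightarrow> 0\<close>, so that
  \<open>c \<ge> t\<^sup>2 \<delta> / 2\<close> for every \<open>t\<close>, which is absurd. Hence the half-space of \<open>z0\<close> contains a point
  \<open>t z0 + v\<close> of \<open>NP\<close>. As \<open>q\<close> is weakly lower semicontinuous on the complement of \<open>V\<close>,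
  \<open>J (t z0 + v) \<le> liminf J (t z j + v) \<le> c\<close>. Working with \<open>z j\<close> instead of \<open>u j\<close> makes a bound
  on the minimizing sequence superfluous.\<close>

lemma exists_minimizer: "\<exists>u\<in>NP. \<forall>x\<in>NP. J u \<le> J x"
proof -
  have "b n \<noteq> 0"
    using orthonormal[of n n] by auto
  then have "b n \<notin> V"
    by (rule perp_not_in_V) (simp add: orthonormal)
  then have "NP \<noteq> {}"
    using half_space_meets_NP by blast
  define c where "c = (INF u\<in>NP. J u)"
  have bdd: "bdd_below (J ` NP)"
    using J_NP_pos by (intro bdd_belowI2[of _ 0]) (auto intro: less_imp_le)
  have "\<exists>u\<in>NP. J u < c + 1 / real (Suc j)" for j
    using cINF_less_iff[OF \<open>NP \<noteq> {}\<close> bdd, of "c + 1 / real (Suc j)"] unfolding c_def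
    by (simp del: of_nat_Suc)
  then obtain u where u: "\<And>j. u j \<in> NP" "\<And>j. J (u j) < c + 1 / real (Suc j)"
    by metis
  have c_le: "c \<le> J x" if "x \<in> NP" for x
    unfolding c_def using bdd that by (rule cINF_lower)
  have Ju: "(\<lambda>j. J (u j)) \<longlonglongrightarrow> c"
  proof (rule tendsto_sandwich[of "\<lambda>_. c" _ _ "\<lambda>j. c + 1 / real (Suc j)"])
    show "(\<lambda>j. c + 1 / real (Suc j)) \<longlonglongrightarrow> c"
      using tendsto_add[OF tendsto_const LIMSEQ_Suc[OF lim_1_over_n], of c] by simp
    show "\<forall>\<^sub>F j in sequentially. c \<le> J (u j)"
      using u(1) c_le by simp
    show "\<forall>\<^sub>F j in sequentially. J (u j) \<le> c + 1 / real (Suc j)"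
      using u(2) by (simp add: less_imp_le)
  qed simp
  define w where "w j = u j - proj (u j)" for j
  define z where "z j = w j /\<^sub>R norm (w j)" for j
  have w0: "w j \<noteq> 0" for j
    using u(1)[of j] proj_in_V[of "u j"] by (auto simp: w_def NP_def)
  have z_norm: "norm (z j) = 1" for j
    using w0[of j] by (simp add: z_def)
  have z_perp: "z j \<bullet> b i = 0" if "i < n" for i j
    using minus_proj_perp[OF that, of "u j"] by (simp add: z_def w_def)
  have z_le: "J (t *\<^sub>R z j + v) \<le> J (u j)" if "t \<ge> 0" "v \<in> V" for t v j
  proof -
    let ?a = "t / norm (w j)"
    have eq: "t *\<^sub>R z j + v = ?a *\<^sub>R u j + (v - ?a *\<^sub>R proj (u j))"
      by (simp add: z_def w_def divide_inverse algebra_simps)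
    show ?thesis
      unfolding eq using that proj_in_V
      by (intro NP_maximal_le u(1) span_diff span_scale) auto
  qed
  obtain r :: "nat \<Rightarrow> nat" and z0 where r: "strict_mono r" and z0: "weakly_converges (\<lambda>j. z (r j)) z0"
    using bounded_imp_weakly_convergent_subsequence[of z 1] z_norm by auto
  have Jur: "(\<lambda>j. J (u (r j))) \<longlonglongrightarrow> c"
    using LIMSEQ_subseq_LIMSEQ[OF Ju r] by (simp add: o_def)
  have z0_perp: "z0 \<bullet> b i = 0" if "i < n" for i
    using weakly_converges_bounded_linear[OF z0 bounded_linear_inner_left[of "b i"]] z_perp[OF that]
    by (simp add: LIMSEQ_const_iff)
  have "z0 \<noteq> 0"
  proof
    assume "z0 = 0"
    \<comment> \<open>chosen such that \<open>t\<^sup>2 * \<delta> / 2 > c\<close>\<close>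
    define t where "t = sqrt (2 * (\<bar>c\<bar> + 1) / \<delta>)"
    have "t\<^sup>2 = 2 * (\<bar>c\<bar> + 1) / \<delta>"
      unfolding t_def using \<delta>_pos by (intro real_sqrt_pow2) simp
    then have t: "t \<ge> 0" "t\<^sup>2 * \<delta> / 2 = \<bar>c\<bar> + 1"
      using \<delta>_pos by (simp_all add: t_def)
    have "(\<lambda>j. \<bar>c\<bar> + 1 - I (t *\<^sub>R z (r j))) \<longlonglongrightarrow> \<bar>c\<bar> + 1 - I (t *\<^sub>R z0)"
      using I_weak[OF weakly_converges_affine[OF z0, of t 0]] by (intro tendsto_intros) simp
    moreover have "\<bar>c\<bar> + 1 - I (t *\<^sub>R z (r j)) \<le> J (u (r j))" for j
    proof -
      have "\<delta> \<le> q (z (r j)) (z (r j))"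
        using q_coercive[of "z (r j)"] z_perp z_norm by simp
      then have "t\<^sup>2 * \<delta> / 2 \<le> t\<^sup>2 * q (z (r j)) (z (r j)) / 2"
        by (intro divide_right_mono mult_left_mono) auto
      then have "\<bar>c\<bar> + 1 - I (t *\<^sub>R z (r j)) \<le> J (t *\<^sub>R z (r j) + 0)"
        unfolding t(2) by (simp add: J_def q.scaleR_left q.scaleR_right power2_eq_square mult.assoc)
      also have "\<dots> \<le> J (u (r j))"
        using t(1) span_zero by (rule z_le)
      finally show ?thesis .
    qed
    ultimately have "\<bar>c\<bar> + 1 - I (t *\<^sub>R z0) \<le> c"
      using Jur by (blast intro: LIMSEQ_le)
    then show False
      using \<open>z0 = 0\<close> by (simp add: I_zero)
  qed
  then have "z0 \<notin> V"
    using perp_not_in_V z0_perp by blast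
  then obtain t v where tv: "t > 0" "v \<in> V" and m: "t *\<^sub>R z0 + v \<in> NP"
    using half_space_meets_NP by blast
  have "J (t *\<^sub>R z0 + v) \<le> c"
  proof -
    let ?f = "\<lambda>j. (t\<^sup>2 * (2 * q z0 (z (r j)) - q z0 z0) + q v v) / 2 - I (t *\<^sub>R z (r j) + v)"
    have exp: "J (t *\<^sub>R x + v) = (t\<^sup>2 * q x x + q v v) / 2 - I (t *\<^sub>R x + v)"
      if "\<And>i. i < n \<Longrightarrow> x \<bullet> b i = 0" for x
      using q_orth[OF tv(2) that]
      by (simp add: J_def q.add_left q.add_right q.scaleR_left q.scaleR_right q_sym[of x v]
          power2_eq_square)
    have "(\<lambda>j. q z0 (z (r j))) \<longlonglongrightarrow> q z0 z0"
      using weakly_converges_bounded_linear[OF z0 q.bounded_linear_right] .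
    then have "?f \<longlonglongrightarrow> (t\<^sup>2 * (2 * q z0 z0 - q z0 z0) + q v v) / 2 - I (t *\<^sub>R z0 + v)"
      by (intro tendsto_intros I_weak weakly_converges_affine z0) auto
    then have "?f \<longlonglongrightarrow> J (t *\<^sub>R z0 + v)"
      using exp[OF z0_perp] by simp
    moreover have "?f j \<le> J (u (r j))" for j
    proof -
      let ?z = "z (r j)"
      \<comment> \<open>convexity of \<open>q\<close> on the complement of \<open>V\<close>, in the form of a tangent inequality\<close>
      have "0 \<le> \<delta> * (norm (?z - z0))\<^sup>2"
        using \<delta>_pos by simp
      also have "\<dots> \<le> q (?z - z0) (?z - z0)"
        using z_perp z0_perp by (intro q_coercive) (simp add: inner_diff_left)
      finally have "2 * q z0 ?z - q z0 z0 \<le> q ?z ?z"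
        by (simp add: q.diff_left q.diff_right q_sym[of ?z z0])
      then have "t\<^sup>2 * (2 * q z0 ?z - q z0 z0) \<le> t\<^sup>2 * q ?z ?z"
        by (rule mult_left_mono) simp
      then have "?f j \<le> J (t *\<^sub>R ?z + v)"
        using exp[of ?z] z_perp by simp
      also have "\<dots> \<le> J (u (r j))"
        using tv by (intro z_le) auto
      finally show ?thesis .
    qed
    ultimately show ?thesis
      using Jur by (blast intro: LIMSEQ_le)
  qed
  then show ?thesis
    using m c_le by (meson order_trans)
qed

text \<open>As \<open>J\<close> is only continuously differentiable, the constraints defining \<open>NP\<close> are merely
  continuous, which rules out Lagrange multipliers; the minimax description replaces them. Suppose that \<open>dJ u0 \<phi> > 0\<close> and move the half-space of \<open>u0\<close> to that of
  \<open>u0 - \<epsilon> \<phi>\<close>. The latter contains a point \<open>m = t (u0 - \<epsilon> \<phi>) + v\<close> of \<open>NP\<close>, with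
  \<open>J m \<ge> J u0\<close>. By \<open>superlevel_half_spaces_precompact\<close> and the uniqueness of the maximizer in the
  half-space of \<open>u0\<close>, \<open>t \<rightarrow> 1\<close> and \<open>v \<rightarrow> 0\<close> along a sequence \<open>\<epsilon> \<rightarrow> 0\<close>. So \<open>m\<close> and
  \<open>x = t u0 + v = m + t \<epsilon> \<phi>\<close> are both close to \<open>u0\<close>, and the mean value theorem together with the
  continuity of \<open>dJ\<close> gives \<open>J m < J x \<le> J u0\<close>, a contradiction.\<close>

lemma minimizer_critical:
  assumes u0: "u0 \<in> NP" and min: "\<And>x. x \<in> NP \<Longrightarrow> J u0 \<le> J x"
  shows "dJ u0 w = 0"
proof (rule ccontr)
  assume "dJ u0 w \<noteq> 0"
  have lin: "linear (dJ x)" for x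
    using has_derivative_linear[OF J_has_derivative] .
  define \<phi> where "\<phi> = sgn (dJ u0 w) *\<^sub>R w"
  have "dJ u0 \<phi> = \<bar>dJ u0 w\<bar>"
    by (simp add: \<phi>_def linear_scale[OF lin] abs_sgn mult.commute)
  then have "dJ u0 \<phi> > 0"
    using \<open>dJ u0 w \<noteq> 0\<close> by simp
  moreover have "isCont (\<lambda>x. dJ x \<phi>) u0"
    unfolding dJ_def using I_C1 
    by (intro continuous_intros q.continuous) (auto simp: continuous_on_eq_continuous_at)
  ultimately have "eventually (\<lambda>x. dJ x \<phi> > 0) (nhds u0)"
    unfolding isCont_def using order_tendstoD(1) by (force simp: eventually_nhds_conv_at)
  then obtain \<rho> where \<rho>: "\<rho> > 0" "\<And>x. dist x u0 < \<rho> \<Longrightarrow> dJ x \<phi> > 0"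
    unfolding eventually_nhds_metric by blast
  have "u0 \<notin> V"
    using u0 by (simp add: NP_def)
  define \<epsilon> where "\<epsilon> j = 1 / real (Suc j)" for j
  have \<epsilon>: "\<epsilon> \<longlonglongrightarrow> 0" "\<And>j. \<epsilon> j > 0"
    unfolding \<epsilon>_def[abs_def] using LIMSEQ_Suc[OF lim_1_over_n] by auto
  have lim_u: "(\<lambda>j. u0 - \<epsilon> j *\<^sub>R \<phi>) \<longlonglongrightarrow> u0 - 0 *\<^sub>R \<phi>"
    by (intro tendsto_intros \<epsilon>)
  then have "(\<lambda>j. (u0 - \<epsilon> j *\<^sub>R \<phi>) - proj (u0 - \<epsilon> j *\<^sub>R \<phi>)) \<longlonglongrightarrow> u0 - proj u0"
    unfolding proj_def by (intro tendsto_intros) auto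
  moreover have "u0 - proj u0 \<noteq> 0"
    using \<open>u0 \<notin> V\<close> proj_in_V[of u0] by auto
  ultimately have "eventually (\<lambda>j. (u0 - \<epsilon> j *\<^sub>R \<phi>) - proj (u0 - \<epsilon> j *\<^sub>R \<phi>) \<noteq> 0) sequentially"
    by (rule tendsto_imp_eventually_ne)
  then have "eventually (\<lambda>j. u0 - \<epsilon> j *\<^sub>R \<phi> \<notin> V) sequentially"
  proof eventually_elim
    case (elim j)
    let ?x = "u0 - \<epsilon> j *\<^sub>R \<phi>"
    have "?x - proj ?x \<notin> V"
      using elim minus_proj_perp by (rule perp_not_in_V)
    then show ?case
      using proj_in_V span_diff by blast
  qed
  then obtain N where N: "\<And>j. u0 - \<epsilon> (j + N) *\<^sub>R \<phi> \<notin> V"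
    unfolding eventually_sequentially by (meson le_add2)
  \<comment> \<open>the shift by \<open>N\<close> makes every half-space nondegenerate\<close>
  define u where "u j = u0 - \<epsilon> (j + N) *\<^sub>R \<phi>" for j
  have u_lim: "u \<longlonglongrightarrow> u0"
    using LIMSEQ_ignore_initial_segment[OF lim_u, of N] by (simp add: u_def[abs_def])
  have "\<exists>t v. t > 0 \<and> v \<in> V \<and> t *\<^sub>R u j + v \<in> NP" for j
    using half_space_meets_NP[of "u j"] N by (metis u_def)
  then obtain t v where t: "\<And>j. t j > 0" and v: "\<And>j. v j \<in> V" and NP: "\<And>j. t j *\<^sub>R u j + v j \<in> NP"
    by metis
  obtain l :: "nat \<Rightarrow> nat" and t0 v0 where l: "strict_mono l" "t0 \<ge> 0" "v0 \<in> V"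
    and lim: "(\<lambda>j. t (l j)) \<longlonglongrightarrow> t0" "(\<lambda>j. v (l j)) \<longlonglongrightarrow> v0"
    using superlevel_half_spaces_precompact[OF u_lim \<open>u0 \<notin> V\<close>, of t v] t v J_NP_pos[OF NP]
    by (metis less_imp_le)
  have m_lim: "(\<lambda>j. t (l j) *\<^sub>R u (l j) + v (l j)) \<longlonglongrightarrow> t0 *\<^sub>R u0 + v0"
    using LIMSEQ_subseq_LIMSEQ[OF u_lim l(1)] by (intro tendsto_intros lim) (simp add: o_def)
  have "J u0 \<le> J (t0 *\<^sub>R u0 + v0)"
    using tendsto_J[OF m_lim] by (rule LIMSEQ_le_const) (use min NP in auto)
  then have tv0: "t0 = 1" "v0 = 0"
    using NP_maximal[OF u0 l(2,3)] by (auto simp: not_less[symmetric])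
  have m_lim: "(\<lambda>j. t (l j) *\<^sub>R u (l j) + v (l j)) \<longlonglongrightarrow> u0"
    using m_lim tv0 by simp
  have "(\<lambda>j. t (l j) *\<^sub>R u0 + v (l j)) \<longlonglongrightarrow> t0 *\<^sub>R u0 + v0"
    by (intro tendsto_intros lim)
  then have x_lim: "(\<lambda>j. t (l j) *\<^sub>R u0 + v (l j)) \<longlonglongrightarrow> u0"
    using tv0 by simp
  obtain k where k: "dist (t k *\<^sub>R u k + v k) u0 < \<rho>" "dist (t k *\<^sub>R u0 + v k) u0 < \<rho>"
    using eventually_happens[OF eventually_conj[OF tendstoD[OF m_lim \<rho>(1)] tendstoD[OF x_lim \<rho>(1)]]]
    by auto
  let ?m = "t k *\<^sub>R u k + v k" and ?x = "t k *\<^sub>R u0 + v k"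
  let ?e = "t k * \<epsilon> (k + N)"
  have xm: "?x = ?m + ?e *\<^sub>R \<phi>"
    by (simp add: u_def algebra_simps)
  have e: "?e > 0"
    using t \<epsilon>(2) by simp
  obtain h where h: "0 < h" "h < ?e"
    and eq: "J (?m + ?e *\<^sub>R \<phi>) - J (?m + 0 *\<^sub>R \<phi>) = (?e - 0) * dJ (?m + h *\<^sub>R \<phi>) \<phi>"
    using MVT2[OF e, of "\<lambda>h. J (?m + h *\<^sub>R \<phi>)" "\<lambda>h. dJ (?m + h *\<^sub>R \<phi>) \<phi>"]
      J_line_has_derivative by blast
  have "?m + h *\<^sub>R \<phi> = (1 - h / ?e) *\<^sub>R ?m + (h / ?e) *\<^sub>R ?x"
    unfolding xm using e t[of k] \<epsilon>(2)[of "k + N"] by (simp add: algebra_simps)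
  also have "\<dots> \<in> ball u0 \<rho>"
    using k h e by (intro convexD[OF convex_ball]) (auto simp: dist_commute)
  finally have "dJ (?m + h *\<^sub>R \<phi>) \<phi> > 0"
    using \<rho>(2) by (simp add: dist_commute)
  then have "J ?m < J ?x"
    using eq e xm by (smt (verit) add.right_neutral mult_pos_pos scaleR_zero_left)
  moreover have "J ?x \<le> J u0"
    using NP_maximal_le[OF u0] t v by (simp add: less_imp_le)
  moreover have "J u0 \<le> J ?m"
    using min NP by blast
  ultimately show False by linarith
qed

end

section \<open>The energy space in spectral coordinates\<close>

locale energy_space_eigenbasis =
  fixes A :: "('h::{real_inner, complete_space} \<times> 'h) set"
    and \<Lambda> :: "nat \<Rightarrow> real" and \<zeta> :: "nat \<Rightarrow> 'h"
    and \<iota> :: "'e::{real_inner, complete_space} \<Rightarrow> 'h"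
  assumes A: "self_adjoint A" and eigen: "eigen_basis A \<Lambda> \<zeta>" and E: "energy_space A \<iota>"
begin

lemma \<Lambda>_mono: "1 \<le> j \<Longrightarrow> j \<le> k \<Longrightarrow> \<Lambda> j \<le> \<Lambda> k"
  using eigen by (simp add: eigen_basis_def mono_on_def)

lemma \<Lambda>_nonneg: "1 \<le> k \<Longrightarrow> 0 \<le> \<Lambda> k"
  using \<Lambda>_mono[of 1 k] eigen by (simp add: eigen_basis_def)

text \<open>The eigenfunctions are numbered from 1 and Hilbert bases from 0; hence the \<open>Suc\<close>.\<close>

sublocale H: hilbert_basis "\<lambda>k. \<zeta> (Suc k)"
proof
  show "\<zeta> (Suc i) \<bullet> \<zeta> (Suc j) = (if i = j then 1 else 0)" for i j
    using eigen by (simp add: eigen_basis_def)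
  fix x assume x: "x \<bullet> \<zeta> (Suc i) = 0" for i
  have "x \<bullet> \<zeta> k = 0" if "k \<ge> 1" for k
    using x[of "k - 1"] that by simp
  then have "\<zeta> ` {1..} \<subseteq> {y. x \<bullet> y = 0}"
    by auto
  then have "span (\<zeta> ` {1..}) \<subseteq> {y. x \<bullet> y = 0}"
    by (rule span_minimal) (rule subspace_hyperplane)
  then have "closure (span (\<zeta> ` {1..})) \<subseteq> {y. x \<bullet> y = 0}"
    by (rule closure_minimal) (rule closed_hyperplane)
  then have "x \<bullet> x = 0"
    using eigen unfolding eigen_basis_def by blast
  then show "x = 0" by simp
qed

lemma op_sqrt_eq: "op_sqrt A = H.diagonal_operator (\<lambda>k. sqrt (\<Lambda> (Suc k)))"
proof (rule H.op_sqrt_eq_diagonal_operator[OF A])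
  show "(\<zeta> (Suc k), \<Lambda> (Suc k) *\<^sub>R \<zeta> (Suc k)) \<in> A" for k
    using eigen by (simp add: eigen_basis_def)
qed (simp add: \<Lambda>_nonneg)

lemma op_apply_op_sqrt_inner:
  "op_apply (op_sqrt A) (\<iota> u) \<bullet> \<zeta> (Suc k) = sqrt (\<Lambda> (Suc k)) * (\<iota> u \<bullet> \<zeta> (Suc k))"
proof -
  have "\<iota> u \<in> Domain (op_sqrt A)"
    using E by (auto simp: energy_space_def bij_betw_def)
  then obtain v where v: "(\<iota> u, v) \<in> op_sqrt A" by blast
  moreover have "single_valued (op_sqrt A)"
    using H.self_adjoint_diagonal_operator by (simp add: op_sqrt_eq self_adjoint_def linear_operator_def)
  ultimately have "op_apply (op_sqrt A) (\<iota> u) = v"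
    unfolding op_apply_def by (blast dest: single_valuedD)
  then show ?thesis
    using v by (simp add: op_sqrt_eq H.diagonal_operator_def)
qed

lemma linear_\<iota>: "linear \<iota>"
  using E by (simp add: energy_space_def)

lemma \<iota>_eq_0D: "u = 0" if "\<iota> u = 0"
  using E that linear_0[OF linear_\<iota>] by (metis energy_space_def bij_betw_def injD)

lemma inner_E_sums:
  "(\<lambda>k. (1 + \<Lambda> (Suc k)) * ((\<iota> u \<bullet> \<zeta> (Suc k)) * (\<iota> v \<bullet> \<zeta> (Suc k)))) sums (u \<bullet> v)"
proof -
  have "u \<bullet> v = \<iota> u \<bullet> \<iota> v + op_apply (op_sqrt A) (\<iota> u) \<bullet> op_apply (op_sqrt A) (\<iota> v)"
    using E by (simp add: energy_space_def)
  moreover have "(\<iota> u \<bullet> \<zeta> (Suc k)) * (\<iota> v \<bullet> \<zeta> (Suc k))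
      + (op_apply (op_sqrt A) (\<iota> u) \<bullet> \<zeta> (Suc k)) * (op_apply (op_sqrt A) (\<iota> v) \<bullet> \<zeta> (Suc k))
      = (1 + \<Lambda> (Suc k)) * ((\<iota> u \<bullet> \<zeta> (Suc k)) * (\<iota> v \<bullet> \<zeta> (Suc k)))" for k
  proof -
    have "sqrt (\<Lambda> (Suc k)) * x * (sqrt (\<Lambda> (Suc k)) * y) = (sqrt (\<Lambda> (Suc k)))\<^sup>2 * (x * y)" for x y
      by (simp only: power2_eq_square ac_simps)
    then show ?thesis
      using \<Lambda>_nonneg[of "Suc k"] by (simp add: op_apply_op_sqrt_inner distrib_right)
  qed
  ultimately show ?thesis
    using sums_add[OF H.parseval[of "\<iota> u" "\<iota> v"]
        H.parseval[of "op_apply (op_sqrt A) (\<iota> u)" "op_apply (op_sqrt A) (\<iota> v)"]]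
    by (simp only:)
qed

definition basis :: "nat \<Rightarrow> 'e" where
  "basis k = inv \<iota> (\<zeta> (Suc k)) /\<^sub>R sqrt (1 + \<Lambda> (Suc k))"

lemma \<iota>_basis: "\<iota> (basis k) = \<zeta> (Suc k) /\<^sub>R sqrt (1 + \<Lambda> (Suc k))"
proof -
  have "\<zeta> (Suc k) \<in> Domain (op_sqrt A)"
    unfolding op_sqrt_eq using H.basis_in_diagonal_operator by blast
  then have "\<zeta> (Suc k) \<in> range \<iota>"
    using E by (simp add: energy_space_def bij_betw_def)
  then show ?thesis
    by (simp add: basis_def linear_scale[OF linear_\<iota>] f_inv_into_f)
qed

text \<open>\<open>basis\<close> is orthogonal in \<open>E\<close> as well as in \<open>H\<close>, with coefficients that differ by the
  factor \<open>sqrt (1 + \<Lambda> (Suc k))\<close> only; so the spaces \<open>E_sub\<close> and their complements are the same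
  for both scalar products.\<close>

lemma inner_basis: "u \<bullet> basis k = sqrt (1 + \<Lambda> (Suc k)) * (\<iota> u \<bullet> \<zeta> (Suc k))"
proof (rule sums_unique2[OF inner_E_sums])
  let ?r = "sqrt (1 + \<Lambda> (Suc k))"
  have r: "?r \<noteq> 0" "?r * ?r = 1 + \<Lambda> (Suc k)"
    using \<Lambda>_nonneg[of "Suc k"] by auto
  have "(\<lambda>j. (1 + \<Lambda> (Suc j)) * ((\<iota> u \<bullet> \<zeta> (Suc j)) * (\<iota> (basis k) \<bullet> \<zeta> (Suc j)))) =
      (\<lambda>j. if j = k then ?r * (\<iota> u \<bullet> \<zeta> (Suc k)) else 0)"
    using r by (auto simp: \<iota>_basis H.orthonormal fun_eq_iff divide_inverse[symmetric] field_simps)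
  then show "(\<lambda>j. (1 + \<Lambda> (Suc j)) * ((\<iota> u \<bullet> \<zeta> (Suc j)) * (\<iota> (basis k) \<bullet> \<zeta> (Suc j))))
      sums (?r * (\<iota> u \<bullet> \<zeta> (Suc k)))"
    using sums_single[of k "\<lambda>j. ?r * (\<iota> u \<bullet> \<zeta> (Suc k))"] by simp
qed

lemma inner_basis_eq_0_iff: "u \<bullet> basis k = 0 \<longleftrightarrow> \<iota> u \<bullet> \<zeta> (Suc k) = 0"
  using \<Lambda>_nonneg[of "Suc k"] by (auto simp: inner_basis)

lemma hilbert_basis_basis: "hilbert_basis basis"
proof
  show "basis i \<bullet> basis j = (if i = j then 1 else 0)" for i j
    using \<Lambda>_nonneg[of "Suc j"] by (auto simp: inner_basis \<iota>_basis H.orthonormal)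
  show "x = 0" if "\<And>i. x \<bullet> basis i = 0" for x
    using that by (intro \<iota>_eq_0D H.total) (simp add: inner_basis_eq_0_iff)
qed

lemma E_sub_eq_span: "E_sub \<iota> \<zeta> n = span (basis ` {..<n})"
proof -
  have "span (\<zeta> ` {1..n}) = span (\<iota> ` basis ` {..<n})"
  proof (subst span_eq, intro conjI subsetI)
    fix x assume "x \<in> \<zeta> ` {1..n}"
    then obtain k where "1 \<le> k" "k \<le> n" "x = \<zeta> k"
      by auto
    then have k: "x = \<zeta> (Suc (k - 1))" "k - 1 < n"
      by auto
    have "x = sqrt (1 + \<Lambda> (Suc (k - 1))) *\<^sub>R \<iota> (basis (k - 1))"
      using \<Lambda>_nonneg[of "Suc (k - 1)"] unfolding \<iota>_basis k(1) by simp
    then show "x \<in> span (\<iota> ` basis ` {..<n})"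
      using k(2) by (metis imageI lessThan_iff span_base span_scale)
  next
    fix x assume "x \<in> \<iota> ` basis ` {..<n}"
    then obtain k where k: "k < n" "x = \<zeta> (Suc k) /\<^sub>R sqrt (1 + \<Lambda> (Suc k))"
      by (auto simp: \<iota>_basis)
    have "Suc k \<in> {1..n}"
      using k(1) by simp
    then show "x \<in> span (\<zeta> ` {1..n})"
      unfolding k(2) by (intro span_scale span_base imageI)
  qed
  also have "\<dots> = \<iota> ` span (basis ` {..<n})"
    using linear_span_image[OF linear_\<iota>] .
  finally show ?thesis
    using E by (auto simp: E_sub_def energy_space_def bij_betw_def dest: injD)
qed

lemma q_form_eq: "q_form A \<iota> lam u v = u \<bullet> v - (1 + lam) * (\<iota> u \<bullet> \<iota> v)"
proof -
  have "u \<bullet> v = \<iota> u \<bullet> \<iota> v + op_apply (op_sqrt A) (\<iota> u) \<bullet> op_apply (op_sqrt A) (\<iota> v)"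
    using E by (simp add: energy_space_def)
  then show ?thesis
    by (simp add: q_form_def algebra_simps)
qed

text \<open>In spectral coordinates the form is diagonal with entries \<open>\<Lambda> (Suc k) - lam\<close>, whose sign changes
  exactly at \<open>k = n\<close> if \<open>lam\<close> lies in the \<open>n\<close>-th spectral gap. Its behaviour on the two parts of \<open>E\<close>
  is read off termwise.\<close>

lemma q_form_sums:
  "(\<lambda>k. (\<Lambda> (Suc k) - lam) * ((\<iota> u \<bullet> \<zeta> (Suc k)) * (\<iota> v \<bullet> \<zeta> (Suc k)))) sums q_form A \<iota> lam u v"
  using sums_diff[OF inner_E_sums[of u v] sums_mult[OF H.parseval[of "\<iota> u" "\<iota> v"], of "1 + lam"]]
  by (simp add: q_form_eq algebra_simps)

lemma bounded_bilinear_q_form: "bounded_bilinear (q_form A \<iota> lam)"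
proof
  have norm_\<iota>: "norm (\<iota> u) \<le> norm u" for u
  proof -
    have "\<iota> u \<bullet> \<iota> u \<le> u \<bullet> u"
      using E by (simp add: energy_space_def)
    then show ?thesis
      by (simp add: norm_eq_sqrt_inner)
  qed
  show "\<exists>K. \<forall>u v. norm (q_form A \<iota> lam u v) \<le> norm u * norm v * K"
  proof (intro exI allI)
    fix u v
    have "\<bar>\<iota> u \<bullet> \<iota> v\<bar> \<le> norm u * norm v"
      using Cauchy_Schwarz_ineq2[of "\<iota> u" "\<iota> v"] mult_mono[OF norm_\<iota>[of u] norm_\<iota>[of v]] by simp
    then have "\<bar>1 + lam\<bar> * \<bar>\<iota> u \<bullet> \<iota> v\<bar> \<le> \<bar>1 + lam\<bar> * (norm u * norm v)"
      by (rule mult_left_mono) simp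
    then have "norm (q_form A \<iota> lam u v) \<le> norm u * norm v + \<bar>1 + lam\<bar> * (norm u * norm v)"
      unfolding q_form_eq real_norm_def
      using Cauchy_Schwarz_ineq2[of u v] abs_triangle_ineq4[of "u \<bullet> v" "(1 + lam) * (\<iota> u \<bullet> \<iota> v)"]
      unfolding abs_mult by linarith
    then show "norm (q_form A \<iota> lam u v) \<le> norm u * norm v * (1 + \<bar>1 + lam\<bar>)"
      by (simp add: algebra_simps)
  qed
qed (simp_all add: q_form_eq linear_add[OF linear_\<iota>] linear_scale[OF linear_\<iota>] inner_add_left
    inner_add_right algebra_simps)

lemma coeff_eq_0:
  assumes "v \<in> span (basis ` {..<n})" "n \<le> k"
  shows "\<iota> v \<bullet> \<zeta> (Suc k) = 0"
proof -
  interpret hilbert_basis basis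
    by (rule hilbert_basis_basis)
  have "orthogonal (basis k) v"
    using assms by (intro orthogonal_to_span[OF assms(1)]) (auto simp: orthogonal_def orthonormal)
  then show ?thesis
    by (simp add: orthogonal_def inner_commute[of _ v] inner_basis_eq_0_iff)
qed

lemma q_form_neg:
  assumes n: "\<Lambda> n < lam" "n \<ge> 1" and v: "v \<in> span (basis ` {..<n})" "v \<noteq> 0"
  shows "q_form A \<iota> lam v v < 0"
proof -
  have "q_form A \<iota> lam v v \<le> (\<Lambda> n - lam) * (\<iota> v \<bullet> \<iota> v)"
  proof (rule sums_le[OF _ q_form_sums sums_mult[OF H.parseval]])
    fix k
    show "(\<Lambda> (Suc k) - lam) * ((\<iota> v \<bullet> \<zeta> (Suc k)) * (\<iota> v \<bullet> \<zeta> (Suc k)))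
        \<le> (\<Lambda> n - lam) * ((\<iota> v \<bullet> \<zeta> (Suc k)) * (\<iota> v \<bullet> \<zeta> (Suc k)))"
    proof (cases "k < n")
      case True
      then show ?thesis
        using \<Lambda>_mono[of "Suc k" n] by (intro mult_right_mono) auto
    next
      case False
      then show ?thesis
        using coeff_eq_0[OF v(1), of k] by simp
    qed
  qed
  also have "\<dots> < 0"
    using n(1) \<iota>_eq_0D[of v] v(2) by (intro mult_neg_pos) auto
  finally show ?thesis .
qed

lemma q_form_orthogonal:
  assumes v: "v \<in> span (basis ` {..<n})" and w: "\<And>i. i < n \<Longrightarrow> w \<bullet> basis i = 0"
  shows "q_form A \<iota> lam v w = 0"
proof -
  have "(\<Lambda> (Suc k) - lam) * ((\<iota> v \<bullet> \<zeta> (Suc k)) * (\<iota> w \<bullet> \<zeta> (Suc k))) = 0" for k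
    using coeff_eq_0[OF v, of k] w[of k] by (cases "k < n") (auto simp: inner_basis_eq_0_iff)
  then show ?thesis
    using q_form_sums[of lam v w] sums_unique2[OF _ sums_zero] by (simp only:)
qed

text \<open>The constant is the value at \<open>L = \<Lambda> (Suc n)\<close> of \<open>(L - lam) / (1 + L)\<close>, which increases with \<open>L\<close>
  because \<open>1 + lam > 0\<close>.\<close>

lemma q_form_coercive:
  assumes lam: "0 \<le> lam" and w: "\<And>i. i < n \<Longrightarrow> w \<bullet> basis i = 0"
  shows "(\<Lambda> (Suc n) - lam) / (1 + \<Lambda> (Suc n)) * (norm w)\<^sup>2 \<le> q_form A \<iota> lam w w"
proof -
  let ?M = "\<Lambda> (Suc n)"
  have M: "0 \<le> ?M"
    by (simp add: \<Lambda>_nonneg)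
  have "(?M - lam) / (1 + ?M) * (w \<bullet> w) \<le> q_form A \<iota> lam w w"
  proof (rule sums_le[OF _ sums_mult[OF inner_E_sums] q_form_sums])
    fix k
    let ?a = "(\<iota> w \<bullet> \<zeta> (Suc k)) * (\<iota> w \<bullet> \<zeta> (Suc k))"
    show "(?M - lam) / (1 + ?M) * ((1 + \<Lambda> (Suc k)) * ?a) \<le> (\<Lambda> (Suc k) - lam) * ?a"
    proof (cases "k < n")
      case True
      then show ?thesis
        using w[of k] by (simp add: inner_basis_eq_0_iff)
    next
      case False
      then have "?M \<le> \<Lambda> (Suc k)"
        by (intro \<Lambda>_mono) auto
      then have "?M * (1 + lam) \<le> \<Lambda> (Suc k) * (1 + lam)"
        using lam by (intro mult_right_mono) auto
      then have "(?M - lam) / (1 + ?M) * (1 + \<Lambda> (Suc k)) \<le> \<Lambda> (Suc k) - lam"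
        using M by (simp add: field_simps)
      then have "(?M - lam) / (1 + ?M) * (1 + \<Lambda> (Suc k)) * ?a \<le> (\<Lambda> (Suc k) - lam) * ?a"
        by (rule mult_right_mono) simp
      then show ?thesis
        by (simp only: mult.assoc)
    qed
  qed
  then show ?thesis
    by (simp add: power2_norm_eq_inner)
qed

end

section \<open>Ground states\<close>

theorem theorem1p7:
  fixes A :: "('h::{real_inner, complete_space} \<times> 'h) set"
    and \<Lambda> :: "nat \<Rightarrow> real" and \<zeta> :: "nat \<Rightarrow> 'h"
    and \<iota> :: "'e::{real_inner, complete_space} \<Rightarrow> 'h"
    and I :: "'e \<Rightarrow> real" and I' :: "'e \<Rightarrow> 'e \<Rightarrow>\<^sub>L real"
    and n :: nat and lam :: real
  assumes H_separable: "separable_space (euclidean :: 'h topology)"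
    and H_infinite_dim: "\<nexists>B :: 'h set. finite B \<and> span B = UNIV"
    and A_op: "self_adjoint A" "nonneg_operator A" "compact_resolvent A"
    and eigen: "eigen_basis A \<Lambda> \<zeta>"
    and E: "energy_space A \<iota>"
    and I_deriv: "\<And>u. (I has_derivative blinfun_apply (I' u)) (at u)"
    and I_C1: "continuous_on UNIV I'"
    and I_zero: "I 0 = 0" "I' 0 = 0"
    and I_weak: "\<And>x u. weakly_converges x u \<Longrightarrow> (\<lambda>k. I (x k)) \<longlonglongrightarrow> I u"
    and I_pos: "\<And>u. u \<noteq> 0 \<Longrightarrow> I u > 0"
    and I_mono: "\<And>u. u \<noteq> 0 \<Longrightarrow> mono_on {0<..} (\<lambda>t. I (t *\<^sub>R u) / t\<^sup>2)"
    and I_lim_0: "\<And>u. u \<noteq> 0 \<Longrightarrow> ((\<lambda>t. I (t *\<^sub>R u) / t\<^sup>2) \<longlongrightarrow> 0) (at_right 0)"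
    and I_lim_inf: "\<And>u. u \<noteq> 0 \<Longrightarrow> filterlim (\<lambda>t. I (t *\<^sub>R u) / t\<^sup>2) at_top at_top"
    and I_ineq: "\<And>u v s. u \<noteq> 0 \<Longrightarrow> s \<ge> -1 \<Longrightarrow>
        I u - I ((1 + s) *\<^sub>R u + v)
          + blinfun_apply (I' u) ((s * (s / 2 + 1)) *\<^sub>R u + (1 + s) *\<^sub>R v) \<le> 0"
    and I_strict: "\<And>u s. u \<noteq> 0 \<Longrightarrow> s \<ge> -1 \<Longrightarrow> s \<noteq> 0 \<Longrightarrow>
        I u - I ((1 + s) *\<^sub>R u) + blinfun_apply (I' u) ((s * (s / 2 + 1)) *\<^sub>R u) < 0"
    and n: "n \<ge> 1" "\<Lambda> n < \<Lambda> (n + 1)"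
    and lam: "\<Lambda> n < lam" "lam < \<Lambda> (n + 1)"
  shows "let J = J_fun A \<iota> I lam;
             NP = Nehari_Pankov A \<iota> \<zeta> I n lam;
             c = (INF u\<in>NP. ereal (J u))
         in NP \<noteq> {} \<and>
            {u. u \<noteq> 0 \<and> critical_point J u} \<subseteq> NP \<and>
            c = (INF u\<in>UNIV - E_sub \<iota> \<zeta> n. SUP w\<in>F_plus \<iota> \<zeta> n u. ereal (J w)) \<and>
            c > 0 \<and>
            (\<exists>u\<in>NP. ereal (J u) = c) \<and>
            (\<forall>u. is_arg_min J (\<lambda>v. v \<in> NP) u \<longrightarrow> critical_point J u) \<and>
            (\<forall>u. is_arg_min J (\<lambda>v. v \<in> NP) u \<longrightarrow> ground_state J u)"
proof -
  interpret energy_space_eigenbasis A \<Lambda> \<zeta> \<iota>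
    using A_op(1) eigen E by unfold_locales
  interpret F: indefinite_functional basis "q_form A \<iota> lam" n
    "(\<Lambda> (Suc n) - lam) / (1 + \<Lambda> (Suc n))" I I'
  proof (intro indefinite_functional.intro hilbert_basis_basis indefinite_functional_axioms.intro)
    show "q_form A \<iota> lam u v = q_form A \<iota> lam v u" for u v
      by (simp add: q_form_def inner_commute)
    show "0 < (\<Lambda> (Suc n) - lam) / (1 + \<Lambda> (Suc n))"
      using lam \<Lambda>_nonneg[of "Suc n"] by simp
    show "(\<Lambda> (Suc n) - lam) / (1 + \<Lambda> (Suc n)) * (norm w)\<^sup>2 \<le> q_form A \<iota> lam w w"
      if "\<And>i. i < n \<Longrightarrow> w \<bullet> basis i = 0" for w
      using that lam(1) \<Lambda>_nonneg[OF n(1)] by (intro q_form_coercive) auto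
  qed (fact bounded_bilinear_q_form q_form_neg[OF lam(1) n(1)] q_form_orthogonal I_deriv I_C1
      I_zero(1) I_weak I_pos I_mono I_lim_0 I_lim_inf I_ineq I_strict)+
  let ?J = "J_fun A \<iota> I lam" and ?NP = "Nehari_Pankov A \<iota> \<zeta> I n lam"
  let ?c = "INF u\<in>?NP. ereal (?J u)"
  have J: "?J = F.J"
    by (simp add: fun_eq_iff J_fun_def F.J_def)
  have V: "E_sub \<iota> \<zeta> n = F.V"
    by (rule E_sub_eq_span)
  have "frechet_derivative ?J (at u) = F.dJ u" for u
    unfolding J by (rule frechet_derivative_at[OF F.J_has_derivative, symmetric])
  then have NP: "?NP = F.NP"
    by (auto simp: Nehari_Pankov_def F.NP_def F_sub_def V)
  have crit: "critical_point ?J u \<longleftrightarrow> (\<forall>w. F.dJ u w = 0)" for u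
    unfolding critical_point_def J
    using F.J_has_derivative[of u] has_derivative_unique[OF F.J_has_derivative[of u]]
    by (metis (no_types, lifting) ext)
  obtain u0 where u0: "u0 \<in> F.NP" and min: "\<And>x. x \<in> F.NP \<Longrightarrow> F.J u0 \<le> F.J x"
    using F.exists_minimizer by blast
  have c: "?c = ereal (F.J u0)"
    unfolding NP J using u0 min by (intro antisym INF_lower INF_greatest) auto
  have crit_NP: "u \<in> F.NP" if "u \<noteq> 0" "critical_point ?J u" for u
    using that F.critical_imp_NP crit by blast
  have minimax: "?c = (INF u\<in>UNIV - E_sub \<iota> \<zeta> n. SUP w\<in>F_plus \<iota> \<zeta> n u. ereal (?J w))"
    unfolding c unfolding J
  proof (rule antisym)
    show "ereal (F.J u0) \<le> (INF u\<in>UNIV - E_sub \<iota> \<zeta> n. SUP w\<in>F_plus \<iota> \<zeta> n u. ereal (F.J w))"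
    proof (rule INF_greatest)
      fix u assume "u \<in> UNIV - E_sub \<iota> \<zeta> n"
      then obtain t v where tv: "t > 0" "v \<in> F.V" "t *\<^sub>R u + v \<in> F.NP"
        using F.half_space_meets_NP[of u] V by auto
      then have "t *\<^sub>R u + v \<in> F_plus \<iota> \<zeta> n u"
        by (auto simp: F_plus_def V add.commute)
      then show "ereal (F.J u0) \<le> (SUP w\<in>F_plus \<iota> \<zeta> n u. ereal (F.J w))"
        by (rule SUP_upper2) (simp add: min tv(3))
    qed
    have "u0 \<in> UNIV - E_sub \<iota> \<zeta> n"
      using u0 by (simp add: V F.NP_def)
    then show "(INF u\<in>UNIV - E_sub \<iota> \<zeta> n. SUP w\<in>F_plus \<iota> \<zeta> n u. ereal (F.J w)) \<le> ereal (F.J u0)"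
    proof (rule INF_lower2, intro SUP_least)
      fix w assume "w \<in> F_plus \<iota> \<zeta> n u0"
      then obtain v t where "w = t *\<^sub>R u0 + v" "v \<in> F.V" "t > 0"
        by (auto simp: F_plus_def V add.commute)
      then show "ereal (F.J w) \<le> ereal (F.J u0)"
        using F.NP_maximal_le[OF u0, of t v] by simp
    qed
  qed
  have min_crit: "critical_point ?J u" if "is_arg_min ?J (\<lambda>v. v \<in> ?NP) u" for u
    using that F.minimizer_critical[of u] crit[of u] unfolding NP J is_arg_min_def
    by (simp add: not_less)
  have "ground_state ?J u" if u: "is_arg_min ?J (\<lambda>v. v \<in> ?NP) u" for u
  proof -
    have "u \<noteq> 0"
      using u span_zero by (auto simp: is_arg_min_def NP F.NP_def)
    then show ?thesis
      using u min_crit[OF u] crit_NP unfolding ground_state_def is_arg_min_def NP by blast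
  qed
  then show ?thesis
    unfolding Let_def
    using minimax min_crit u0 c F.J_NP_pos[OF u0] crit_NP by (auto simp: NP J)
qed

end
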